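(* There exist $f\in H^\infty(\mathbb T^\infty)$ and a boundary-point-independent sequence of vectors $R^{(s)}=(R^{(s)}_n)_{n\ge1}\in c_0\cap[0,1)^\infty$, $s\ge1$ (that is, the sequence is fixed independently of $e^{i\theta}\in\mathbb T^\infty$), such that (1) $R^{(s)}_1\ge R^{(s)}_2\ge\cdots$ for every $s$; (2) $R^{(s)}_n\to1$ as $s\to\infty$ for every fixed $n$; (3) for $m_\infty$-almost every $e^{i\theta}\in\mathbb T^\infty$, the sequence $\bigl(f(R^{(s)}e^{i\theta})\bigr)_{s\ge1}$ has a subsequence converging to $0$, and therefore does not converge to $f^*(e^{i\theta})$. In general, for a fixed $n$, the sequence $(R^{(s)}_n)_{s\ge1}$ is not monotone in $s$.
   Context: $\mathbb T$ is the unit circle with normalized Haar measure $m$, $\mathbb D$ is the open unit disc, $\mathbb T^\infty=\prod_{n\ge1}\mathbb T$, $\mathbb D^\infty=\prod_{n\ge1}\mathbb D$, and $m_\infty=\bigotimes_{n\ge1}m$ is the product probability measure on $\mathbb T^\infty$. $c_0$ is the Banach space (sup norm) of complex sequences $(z_n)_{n\ge1}$ with $z_n\to0$. For $\theta=(\theta_n)$ and $r=(r_n)\in[0,1)^\infty$, write $e^{i\theta}=(e^{i\theta_n})_{n\ge1}\in\mathbb T^\infty$ and $re^{i\theta}=(r_ne^{i\theta_n})_{n\ge1}$. $H^\infty(\mathbb T^\infty)$ is the subspace of those $g\in L^\infty(\mathbb T^\infty,m_\infty)$ whose Fourier coefficients $\hat g(\gamma)=\int_{\mathbb T^\infty} g(w)\overline{w^\gamma}\,dm_\infty(w)$,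 indexed by finitely supported $\gamma\in\mathbb Z^{\infty}$ with $w^\gamma=\prod_n w_n^{\gamma_n}$, vanish unless all $\gamma_n\ge0$. Each $g\in H^\infty(\mathbb T^\infty)$ has a unique bounded holomorphic extension to $c_0\cap\mathbb D^\infty$ (the open unit ball of $c_0$), namely the bounded holomorphic function on $c_0\cap\mathbb D^\infty$ whose monomial coefficients (computed on finitely supported points) are the Fourier coefficients $\hat g(\alpha)$, $\alpha\ge0$ finitely supported; this correspondence is an isometric bijection onto the bounded holomorphic functions on $c_0\cap\mathbb D^\infty$. The same symbol $f$ is used for the holomorphic extension, and $f^*$ denotes the boundary function, i.e. the element of $L^\infty(\mathbb T^\infty)$ itself. The function $f$ is one for which $f^*\ne0$ $m_\infty$-almost everywhere, which is what the word "therefore" in (3) refers to. *)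

theory Defs
  imports "HOL-Probability.Probability"
begin

(* Sequences (z_n) with n >= 1 are functions on nat, index 0 standing for n = 1. *)

section \<open>The infinite polytorus\<close>

definition haar_circle :: "complex measure" where
  "haar_circle =
     distr (uniform_measure lborel {0..<2 * pi}) (restrict_space borel (sphere 0 1)) cis"

definition haar_polytorus :: "(nat \<Rightarrow> complex) measure" where
  "haar_polytorus = PiM UNIV (\<lambda>_. haar_circle)"

lemma prob_space_haar_circle: "prob_space haar_circle"
proof -
  interpret U: prob_space "uniform_measure lborel {0..<2 * pi}"
    by (rule prob_space_uniform_measure) auto
  have "cis \<in> borel_measurable borel"
    by (intro borel_measurable_continuous_onI continuous_intros)
  then have "cis \<in> uniform_measure lborel {0..<2 * pi} \<rightarrow>\<^sub>M restrict_space borel (sphere 0 1)"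
    by (intro measurable_restrict_space2) auto
  then show ?thesis
    unfolding haar_circle_def by (rule U.prob_space_distr)
qed

lemma space_haar_polytorus: "space haar_polytorus = {w. \<forall>n. cmod (w n) = 1}"
  by (auto simp: haar_polytorus_def haar_circle_def space_PiM PiE_def space_restrict_space)

lemma prob_space_haar_polytorus: "prob_space haar_polytorus"
  unfolding haar_polytorus_def by (intro prob_space_PiM prob_space_haar_circle)

definition fourier_coeff :: "((nat \<Rightarrow> complex) \<Rightarrow> complex) \<Rightarrow> (nat \<Rightarrow> int) \<Rightarrow> complex" where
  "fourier_coeff g \<gamma> =
     (LINT w|haar_polytorus. g w * cnj (\<Prod>n | \<gamma> n \<noteq> 0. w n powi \<gamma> n))"

(* Elements are functions representing classes in L^infinity, not the classes themselves. *)
definition Hinf_polytorus :: "((nat \<Rightarrow> complex) \<Rightarrow> complex) set" where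
  "Hinf_polytorus =
     {g \<in> borel_measurable haar_polytorus.
        (\<exists>C. AE w in haar_polytorus. cmod (g w) \<le> C) \<and>
        (\<forall>\<gamma>. finite {n. \<gamma> n \<noteq> 0} \<and> \<not> (\<forall>n. \<gamma> n \<ge> 0) \<longrightarrow> fourier_coeff g \<gamma> = 0)}"

section \<open>Bounded holomorphic functions on the open unit ball of \<open>c\<^sub>0\<close>\<close>

definition c0 :: "(nat \<Rightarrow> complex) set" where
  "c0 = {z. z \<longlonglongrightarrow> 0}"

definition c0_norm :: "(nat \<Rightarrow> complex) \<Rightarrow> real" where
  "c0_norm z = (SUP n. cmod (z n))"

definition c0_ball :: "(nat \<Rightarrow> complex) set" where
  "c0_ball = {z \<in> c0. \<forall>n. cmod (z n) < 1}"

definition c0_dual :: "((nat \<Rightarrow> complex) \<Rightarrow> complex) set" where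
  "c0_dual =
     {L. (\<forall>h\<in>c0. \<forall>k\<in>c0. \<forall>a b. L (\<lambda>n. a * h n + b * k n) = a * L h + b * L k) \<and>
         (\<exists>K. \<forall>h\<in>c0. cmod (L h) \<le> K * c0_norm h)}"

(* Holomorphy on an open subset of a complex Banach space: complex Frechet differentiability
   at every point. *)
definition holomorphic_on_c0_ball :: "((nat \<Rightarrow> complex) \<Rightarrow> complex) \<Rightarrow> bool" where
  "holomorphic_on_c0_ball F \<longleftrightarrow>
     (\<forall>z\<in>c0_ball. \<exists>L\<in>c0_dual. \<forall>e>0. \<exists>d>0. \<forall>h\<in>c0.
        c0_norm h < d \<and> (\<lambda>n. z n + h n) \<in> c0_ball \<longrightarrow>
        cmod (F (\<lambda>n. z n + h n) - F z - L h) \<le> e * c0_norm h)"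

(* For z supported in the first N coordinates, all terms in which some other coordinate
   has positive exponent vanish, so this is the power series of F on the N-dimensional polydisc. *)
definition has_monomial_coeffs ::
    "((nat \<Rightarrow> complex) \<Rightarrow> complex) \<Rightarrow> ((nat \<Rightarrow> nat) \<Rightarrow> complex) \<Rightarrow> bool" where
  "has_monomial_coeffs F c \<longleftrightarrow>
     (\<forall>z\<in>c0_ball. finite {n. z n \<noteq> 0} \<longrightarrow>
        ((\<lambda>\<alpha>. c \<alpha> * (\<Prod>n | \<alpha> n \<noteq> 0. z n ^ \<alpha> n)) has_sum F z) {\<alpha>. finite {n. \<alpha> n \<noteq> 0}})"

(* F is determined by g on c0_ball only; its values elsewhere are irrelevant. *)
definition is_holomorphic_extension ::
    "((nat \<Rightarrow> complex) \<Rightarrow> complex) \<Rightarrow> ((nat \<Rightarrow> complex) \<Rightarrow> complex) \<Rightarrow> bool" where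
  "is_holomorphic_extension g F \<longleftrightarrow>
     holomorphic_on_c0_ball F \<and>
     (\<exists>C. \<forall>z\<in>c0_ball. cmod (F z) \<le> C) \<and>
     has_monomial_coeffs F (\<lambda>\<alpha>. fourier_coeff g (\<lambda>n. int (\<alpha> n)))"

end

(*
  Writing psi_d(z) = (1 - z) / (1 - (1 - d) z), which has psi_d(0) = 1, |psi_d| <= 1 + d on the disc and
  mean square at most 1 + d on the circle, put f(z) = prod_n psi_{d_n}(z_n^{k_n}) with sum d_n finite.  The
  coordinates are grouped in blocks: block b has 2^L / 4^b coordinates with d_n = 2^-L, where L = 8^(b+3).
  The mean squares make the products over whole blocks converge absolutely to a nonzero limit almost everywhere.

  Near z = 1 the radius 1 - 2^-l sees |psi_d| <= 1 - c d 2^l on arcs of length about 2^-l, so the minimum of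
  |psi_d| over the radii l = 1, ..., L has mean at most 1 + d (1 - c L): the L scales contribute equally.  If the
  radius can be chosen for each coordinate independently, the mean of the product over block b is therefore at
  most exp(4^-b (1 - c L)), which is summable although sum d_n converges.  There are finitely many such choices
  per block, so a single sequence of radii runs through all of them.  The exponents k_n decrease so fast inside a
  block that every choice gives decreasing radii for the z_n themselves.
*)
theory Submission
  imports Defs "HOL-Complex_Analysis.Complex_Analysis"
begin

section \<open>The Haar measure of the circle\<close>

text \<open>The obstacle is that smallness at w needs a radius adapted to each coordinate, while the
  radii must decrease in n. The exponents separate the two demands: z -> z^k preserves Haar measure,
  so k_n changes no mean of psi_d, of its square or of the minima over radii, and can serve the
  ordering of the radii alone.

  Blocks are needed already for the boundary function. The mean of |psi_d - 1| is of order d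
  log(1/d), that is d L, and these means add up to about 8^b / 4^b over block b, so coordinatewise
  absolute convergence in mean fails; the same logarithm is what makes the minima small. In the mean
  square of a whole block no logarithm appears, because the factors are independent with mean 1.

  Values of f are computed only at finitely supported points: the radii vanish beyond the block in
  question, so f is a finite product there, and the coordinates before the block contribute a
  bounded amount.\<close>

lemma borel_measurable_haar_circle :
  assumes "f \<in> borel_measurable borel"
  shows "f \<in> borel_measurable haar_circle"
proof -
  have "f \<in> borel_measurable (restrict_space borel (sphere 0 1))"
    using assms by (rule measurable_restrict_space1)
  then show ?thesis
    by (simp add: haar_circle_def cong: measurable_cong_sets)
qed

lemma space_haar_circle: "space haar_circle = sphere 0 1"
  by (simp add: haar_circle_def space_restrict_space)

lemma prob_space_uniform_angle: "prob_space (uniform_measure lborel {0..<2 * pi})"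
  by (rule prob_space_uniform_measure) auto

lemma measurable_cis_circle:
  "cis \<in> uniform_measure lborel {0..<2 * pi} \<rightarrow>\<^sub>M restrict_space borel (sphere 0 1)"
proof -
  have "cis \<in> borel_measurable borel"
    by (intro borel_measurable_continuous_onI continuous_intros)
  then show ?thesis
    by (intro measurable_restrict_space2) auto
qed

lemma integral_haar_circle:
  fixes f :: "complex \<Rightarrow> 'a::{banach, second_countable_topology}"
  assumes "f \<in> borel_measurable borel"
  shows "(LINT z|haar_circle. f z) = (LINT t|uniform_measure lborel {0..<2 * pi}. f (cis t))"
  unfolding haar_circle_def
  by (rule integral_distr[OF measurable_cis_circle measurable_restrict_space1[OF assms]])

lemma nn_integral_haar_circle:
  assumes "f \<in> borel_measurable (restrict_space borel (sphere 0 1))"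
  shows "(\<integral>\<^sup>+z. f z \<partial>haar_circle)
    = (\<integral>\<^sup>+t. f (cis t) * indicator {0..<2 * pi} t \<partial>lborel) / (2 * pi)"
proof -
  have [measurable]: "(\<lambda>t. f (cis t)) \<in> borel_measurable borel"
    using measurable_compose[OF measurable_cis_circle assms]
    by (simp cong: measurable_cong_sets)
  have "(\<integral>\<^sup>+z. f z \<partial>haar_circle) = (\<integral>\<^sup>+t. f (cis t) \<partial>uniform_measure lborel {0..<2 * pi})"
    unfolding haar_circle_def using assms by (intro nn_integral_distr measurable_cis_circle) auto
  also have "\<dots> = (\<integral>\<^sup>+t. f (cis t) * indicator {0..<2 * pi} t \<partial>lborel) / emeasure lborel {0..<2 * pi}"
    by (intro nn_integral_uniform_measure) auto
  finally show ?thesis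
    by simp
qed

lemma nn_integral_circle_translate:
  fixes f :: "complex \<Rightarrow> ennreal"
  assumes [measurable]: "(\<lambda>t. f (cis t)) \<in> borel_measurable borel"
  shows "(\<integral>\<^sup>+t. f (cis t) * indicator {2 * pi * real j..<2 * pi * real (Suc j)} t \<partial>lborel)
       = (\<integral>\<^sup>+t. f (cis t) * indicator {0..<2 * pi} t \<partial>lborel)"
proof -
  have "(\<integral>\<^sup>+t. f (cis t) * indicator {2 * pi * real j..<2 * pi * real (Suc j)} t \<partial>lborel)
      = ennreal \<bar>1\<bar> * (\<integral>\<^sup>+t. f (cis (2 * pi * real j + 1 * t)) *
          indicator {2 * pi * real j..<2 * pi * real (Suc j)} (2 * pi * real j + 1 * t) \<partial>lborel)"
    by (rule nn_integral_real_affine) auto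
  also have "\<dots> = (\<integral>\<^sup>+t. f (cis t) * indicator {0..<2 * pi} t \<partial>lborel)"
  proof -
    have "cis (2 * pi * real j + t) = cis t" for t
      by (simp add: cis_mult[symmetric] cis_multiple_2pi)
    then have "f (cis (2 * pi * real j + 1 * t)) *
          indicator {2 * pi * real j..<2 * pi * real (Suc j)} (2 * pi * real j + 1 * t)
        = f (cis t) * indicator {0..<2 * pi} t" for t
      by (auto simp: indicator_def algebra_simps)
    then show ?thesis by simp
  qed
  finally show ?thesis .
qed

lemma nn_integral_circle_windings:
  fixes f :: "complex \<Rightarrow> ennreal"
  assumes [measurable]: "(\<lambda>t. f (cis t)) \<in> borel_measurable borel"
  shows "(\<integral>\<^sup>+t. f (cis t) * indicator {0..<2 * pi * real k} t \<partial>lborel)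
       = of_nat k * (\<integral>\<^sup>+t. f (cis t) * indicator {0..<2 * pi} t \<partial>lborel)"
proof (induction k)
  case (Suc k)
  have split: "(indicator {0..<b} t :: ennreal) = indicator {0..<a} t + indicator {a..<b} t"
    if "0 \<le> a" "a \<le> b" for a b t :: real
    using that by (auto simp: indicator_def)
  have "(indicator {0..<2 * pi * real (Suc k)} t :: ennreal) = indicator {0..<2 * pi * real k} t
      + indicator {2 * pi * real k..<2 * pi * real (Suc k)} t" for t
    by (rule split) (auto intro!: mult_left_mono)
  then have "(\<integral>\<^sup>+t. f (cis t) * indicator {0..<2 * pi * real (Suc k)} t \<partial>lborel)
      = (\<integral>\<^sup>+t. f (cis t) * indicator {0..<2 * pi * real k} t
         + f (cis t) * indicator {2 * pi * real k..<2 * pi * real (Suc k)} t \<partial>lborel)"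
    by (simp only: distrib_left)
  also have "\<dots> = (\<integral>\<^sup>+t. f (cis t) * indicator {0..<2 * pi * real k} t \<partial>lborel)
      + (\<integral>\<^sup>+t. f (cis t) * indicator {2 * pi * real k..<2 * pi * real (Suc k)} t \<partial>lborel)"
    by (intro nn_integral_add) auto
  also have "\<dots> = of_nat (Suc k) * (\<integral>\<^sup>+t. f (cis t) * indicator {0..<2 * pi} t \<partial>lborel)"
    by (simp only: Suc.IH nn_integral_circle_translate[OF assms]) (simp add: distrib_right add.commute)
  finally show ?case .
qed simp

lemma measurable_power_circle:
  "(\<lambda>z. z ^ k) \<in> restrict_space borel (sphere 0 1) \<rightarrow>\<^sub>M restrict_space borel (sphere 0 (1::real) :: complex set)"
  by (intro measurable_restrict_space2 measurable_restrict_space1)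
     (auto simp: norm_power space_restrict_space)

text \<open>The substitution t -> k t turns one turn for \<open>f (z ^ k)\<close> into k turns for
  \<open>f\<close>, each with the same integral. Cancelling k in \<open>ennreal\<close> is
  legitimate as it is finite and nonzero.\<close>

lemma nn_integral_haar_circle_power:
  assumes "0 < k" and [measurable]: "f \<in> borel_measurable haar_circle"
  shows "(\<integral>\<^sup>+z. f (z ^ k) \<partial>haar_circle) = (\<integral>\<^sup>+z. f z \<partial>haar_circle)"
proof -
  have f: "f \<in> borel_measurable (restrict_space borel (sphere 0 1))"
    using assms(2) by (simp add: haar_circle_def cong: measurable_cong_sets)
  have fc [measurable]: "(\<lambda>t. f (cis t)) \<in> borel_measurable borel"
    using measurable_compose[OF measurable_cis_circle f] by (simp cong: measurable_cong_sets)
  let ?I = "\<integral>\<^sup>+t. f (cis t) * indicator {0..<2 * pi} t \<partial>lborel"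
  let ?J = "\<integral>\<^sup>+t. f (cis t ^ k) * indicator {0..<2 * pi} t \<partial>lborel"
  have "of_nat k * ?I = (\<integral>\<^sup>+t. f (cis t) * indicator {0..<2 * pi * real k} t \<partial>lborel)"
    by (rule nn_integral_circle_windings[symmetric]) measurable
  also have "\<dots> = ennreal \<bar>real k\<bar> * (\<integral>\<^sup>+t. f (cis (0 + real k * t)) *
      indicator {0..<2 * pi * real k} (0 + real k * t) \<partial>lborel)"
    using assms(1) by (intro nn_integral_real_affine) auto
  also have "(\<lambda>t. f (cis (0 + real k * t)) * indicator {0..<2 * pi * real k} (0 + real k * t))
      = (\<lambda>t. f (cis t ^ k) * indicator {0..<2 * pi} t)"
  proof
    fix t
    have "cis (real k * t) = cis t ^ k"
      by (rule Complex.DeMoivre[symmetric])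
    moreover have "real k * t < 2 * pi * real k \<longleftrightarrow> t < 2 * pi"
      using assms(1) by (simp add: mult.commute[of "2 * pi"])
    ultimately show "f (cis (0 + real k * t)) * indicator {0..<2 * pi * real k} (0 + real k * t)
        = f (cis t ^ k) * indicator {0..<2 * pi} t"
      using assms(1) by (simp add: indicator_def zero_le_mult_iff)
  qed
  finally have "of_nat k * ?I = of_nat k * ?J"
    by (simp add: ennreal_of_nat_eq_real_of_nat)
  then have "?I = ?J"
    using assms(1) by (simp add: ennreal_mult_cancel_left)
  moreover have "(\<lambda>z. f (z ^ k)) \<in> borel_measurable (restrict_space borel (sphere 0 1))"
    using measurable_compose[OF measurable_power_circle f] .
  ultimately show ?thesis
    by (simp add: nn_integral_haar_circle f)
qed

text \<open>Lets the exponents be ignored in every one-coordinate integral.\<close>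

lemma distr_haar_circle_power:
  assumes "0 < k"
  shows "distr haar_circle haar_circle (\<lambda>z. z ^ k) = haar_circle"
proof (rule measure_eqI)
  fix A assume "A \<in> sets (distr haar_circle haar_circle (\<lambda>z. z ^ k))"
  then have A [measurable]: "A \<in> sets haar_circle"
    by simp
  have m [measurable]: "(\<lambda>z. z ^ k) \<in> haar_circle \<rightarrow>\<^sub>M haar_circle"
    using measurable_power_circle[of k]
    by (simp add: haar_circle_def cong: measurable_cong_sets)
  have "emeasure (distr haar_circle haar_circle (\<lambda>z. z ^ k)) A
      = (\<integral>\<^sup>+z. indicator A z \<partial>distr haar_circle haar_circle (\<lambda>z. z ^ k))"
    by simp
  also have "\<dots> = (\<integral>\<^sup>+z. indicator A (z ^ k) \<partial>haar_circle)"
    by (rule nn_integral_distr) measurable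
  also have "\<dots> = (\<integral>\<^sup>+z. indicator A z \<partial>haar_circle)"
    using assms by (rule nn_integral_haar_circle_power) measurable
  finally show "emeasure (distr haar_circle haar_circle (\<lambda>z. z ^ k)) A = emeasure haar_circle A"
    by simp
qed simp

lemma integral_haar_circle_power:
  fixes f :: "complex \<Rightarrow> 'a::{banach, second_countable_topology}"
  assumes "0 < k" and f: "f \<in> borel_measurable borel"
  shows "(LINT z|haar_circle. f (z ^ k)) = (LINT z|haar_circle. f z)"
proof -
  have m [measurable]: "(\<lambda>z. z ^ k) \<in> haar_circle \<rightarrow>\<^sub>M haar_circle"
    using measurable_power_circle[of k]
    by (simp add: haar_circle_def cong: measurable_cong_sets)
  have "(LINT z|haar_circle. f (z ^ k)) = (LINT z|distr haar_circle haar_circle (\<lambda>z. z ^ k). f z)"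
    by (rule integral_distr[symmetric, OF m borel_measurable_haar_circle[OF f]])
  then show ?thesis
    by (simp add: distr_haar_circle_power assms)
qed

lemma integral_uniform_angle:
  fixes f :: "real \<Rightarrow> 'a::{banach, second_countable_topology}"
  assumes [measurable]: "f \<in> borel_measurable borel"
  shows "(LINT t|uniform_measure lborel {0..<2 * pi}. f t)
    = (LINT t:{0..<2 * pi}|lborel. f t) /\<^sub>R (2 * pi)"
proof -
  have "(LINT t|uniform_measure lborel {0..<2 * pi}. f t)
      = (LINT t|lborel. (indicator {0..<2 * pi} t / (2 * pi)) *\<^sub>R f t)"
  proof -
    have "uniform_measure lborel {0..<2 * pi}
        = density lborel (\<lambda>t. ennreal (indicator {0..<2 * pi} t / (2 * pi)))"
      unfolding uniform_measure_def
      by (intro arg_cong2[where f = density] ext refl)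
         (auto simp: indicator_def ennreal_1[symmetric] divide_ennreal simp del: ennreal_1)
    then show ?thesis
      by (simp add: integral_density)
  qed
  also have "\<dots> = (LINT t|lborel. (1 / (2 * pi)) *\<^sub>R (indicator {0..<2 * pi} t *\<^sub>R f t))"
    by (simp add: mult.commute)
  also have "\<dots> = (1 / (2 * pi)) *\<^sub>R (LINT t|lborel. indicator {0..<2 * pi} t *\<^sub>R f t)"
    by (rule integral_scaleR_right)
  finally show ?thesis
    by (simp add: set_lebesgue_integral_def inverse_eq_divide)
qed

text \<open>Invariance under powers reduces positive exponents to the integral of \<open>z\<close>,
  found by an antiderivative; negative powers are conjugates of positive ones on the circle.\<close>

lemma integral_haar_circle_powi:
  assumes "j \<noteq> 0"
  shows "(LINT z|haar_circle. z powi j) = 0"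
proof -
  have id: "(LINT z|haar_circle. z) = 0"
  proof -
    have "(LBINT t=ereal 0..ereal (2 * pi). cis t) = - \<i> * cis (2 * pi) - (- \<i> * cis 0)"
    proof (rule interval_integral_FTC_finite)
      show "((\<lambda>t. - \<i> * cis t) has_vector_derivative cis t)
          (at t within {min 0 (2 * pi)..max 0 (2 * pi)})" for t
        unfolding cis_conv_exp
        by (rule derivative_eq_intros field_vector_diff_chain_within refl | simp)+
    qed (intro continuous_intros)
    then have "(LBINT t:{0..<2 * pi}. cis t) = 0"
      by (simp add: interval_integral_Ico)
    moreover have "cis \<in> borel_measurable borel"
      by (intro borel_measurable_continuous_onI continuous_intros)
    ultimately show ?thesis
      by (simp add: integral_haar_circle integral_uniform_angle)
  qed
  have pow: "(LINT z|haar_circle. z ^ n) = 0" if "0 < n" for n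
    using integral_haar_circle_power[OF that, of "\<lambda>z. z"] id by simp
  show ?thesis
  proof (cases "0 < j")
    case True
    then show ?thesis
      using pow[of "nat j"] by (simp add: power_int_def)
  next
    case False
    then have "0 < nat (- j)"
      using assms by simp
    have "(LINT z|haar_circle. z powi j) = (LINT z|haar_circle. cnj (z ^ nat (- j)))"
    proof (rule Bochner_Integration.integral_cong)
      fix z assume "z \<in> space haar_circle"
      then have "cmod z = 1"
        by (simp add: space_haar_circle)
      then show "z powi j = cnj (z ^ nat (- j))"
        using False assms by (simp add: power_int_def inverse_eq_divide complex_div_cnj[of 1])
    qed simp
    then show ?thesis
      using pow[OF \<open>0 < nat (- j)\<close>] by (simp only: Bochner_Integration.integral_cnj) simp
  qed
qed

section \<open>Products of functions of one coordinate\<close>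

lemma borel_measurable_polytorus_coordinate:
  assumes [measurable]: "f \<in> borel_measurable borel"
  shows "(\<lambda>w. f (w n)) \<in> borel_measurable haar_polytorus"
proof -
  have "(\<lambda>w. w n) \<in> haar_polytorus \<rightarrow>\<^sub>M haar_circle"
    unfolding haar_polytorus_def by (rule measurable_component_singleton) simp
  then show ?thesis
    using borel_measurable_haar_circle[OF assms] by (rule measurable_compose)
qed

lemma integrable_haar_circle_bounded:
  fixes f :: "complex \<Rightarrow> 'a::{banach, second_countable_topology}"
  assumes "f \<in> borel_measurable borel" "\<And>z. cmod z = 1 \<Longrightarrow> norm (f z) \<le> C"
  shows "integrable haar_circle f"
proof -
  interpret prob_space haar_circle
    by (rule prob_space_haar_circle)
  show ?thesis
  proof (rule integrable_const_bound)
    show "AE z in haar_circle. norm (f z) \<le> C"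
      by (rule AE_I2) (simp add: space_haar_circle assms(2))
    show "f \<in> borel_measurable haar_circle"
      by (rule borel_measurable_haar_circle[OF assms(1)])
  qed
qed

text \<open>Only finitely many coordinates enter, so the integral passes to a finite marginal, where
  Fubini applies. This is the independence behind all means below.\<close>

lemma integral_polytorus_prod:
  fixes f :: "nat \<Rightarrow> complex \<Rightarrow> 'a::{real_normed_field, banach, second_countable_topology}"
  assumes J: "finite J" and f: "\<And>n. n \<in> J \<Longrightarrow> f n \<in> borel_measurable borel"
    and int: "\<And>n. n \<in> J \<Longrightarrow> integrable haar_circle (f n)"
  shows "(LINT w|haar_polytorus. (\<Prod>n\<in>J. f n (w n))) = (\<Prod>n\<in>J. LINT z|haar_circle. f n z)"
proof -
  interpret product_prob_space "\<lambda>_::nat. haar_circle" UNIV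
    by (intro product_prob_spaceI prob_space_haar_circle)
  have m: "(\<lambda>w. \<Prod>n\<in>J. f n (w n)) \<in> borel_measurable (PiM J (\<lambda>_. haar_circle))"
  proof (intro borel_measurable_prod)
    fix n assume "n \<in> J"
    then have "(\<lambda>w. w n) \<in> PiM J (\<lambda>_. haar_circle) \<rightarrow>\<^sub>M haar_circle"
      by (rule measurable_component_singleton)
    then show "(\<lambda>w. f n (w n)) \<in> borel_measurable (PiM J (\<lambda>_. haar_circle))"
      using borel_measurable_haar_circle[OF f[OF \<open>n \<in> J\<close>]] by (rule measurable_compose)
  qed
  have "(LINT w|haar_polytorus. (\<Prod>n\<in>J. f n (w n)))
      = (LINT w|haar_polytorus. (\<Prod>n\<in>J. f n (restrict w J n)))"
    by simp
  also have "\<dots> = (LINT w|distr haar_polytorus (PiM J (\<lambda>_. haar_circle)) (\<lambda>w. restrict w J). (\<Prod>n\<in>J. f n (w n)))"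
    unfolding haar_polytorus_def
    by (rule integral_distr[symmetric, OF measurable_restrict_subset m]) simp
  also have "distr haar_polytorus (PiM J (\<lambda>_. haar_circle)) (\<lambda>w. restrict w J) = PiM J (\<lambda>_. haar_circle)"
    unfolding haar_polytorus_def using J by (intro distr_PiM_restrict_finite) auto
  also have "(LINT w|PiM J (\<lambda>_. haar_circle). (\<Prod>n\<in>J. f n (w n))) = (\<Prod>n\<in>J. LINT z|haar_circle. f n z)"
    using J int by (rule product_integral_prod)
  finally show ?thesis .
qed

text \<open>Absolute summability permits termwise integration; orthogonality of the powers leaves
  the term \<open>j = i\<close>, and a negative \<open>i\<close> matches none.\<close>

lemma integral_power_series_coeff:
  fixes c :: "nat \<Rightarrow> complex"
  assumes \<phi>: "\<phi> \<in> borel_measurable borel" and c: "summable (\<lambda>j. cmod (c j))"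
    and series: "\<And>z. cmod z \<le> 1 \<Longrightarrow> (\<lambda>j. c j * z ^ j) sums \<phi> z"
  shows "(LINT z|haar_circle. \<phi> z * cnj (z powi i)) = (if 0 \<le> i then c (nat i) else 0)"
proof -
  interpret prob_space haar_circle
    by (rule prob_space_haar_circle)
  have powi: "(\<lambda>z. z powi m :: complex) \<in> borel_measurable borel" for m
    unfolding power_int_def by measurable
  have norm: "cmod (c j * z powi (int j - i)) = cmod (c j)" if "cmod z = 1" for z j
    using that by (simp add: norm_mult norm_power_int)
  have meas: "(\<lambda>z. c j * z powi (int j - i)) \<in> borel_measurable haar_circle" for j
    by (intro borel_measurable_haar_circle borel_measurable_times borel_measurable_const powi)
  have int: "integrable haar_circle (\<lambda>z. c j * z powi (int j - i))" for j
    by (rule integrable_haar_circle_bounded[of _ "cmod (c j)"])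
       (intro borel_measurable_times borel_measurable_const powi, simp add: norm)
  have "(LINT z|haar_circle. \<phi> z * cnj (z powi i))
      = (LINT z|haar_circle. (\<Sum>j. c j * z powi (int j - i)))"
  proof (rule Bochner_Integration.integral_cong)
    fix z assume "z \<in> space haar_circle"
    then have z: "cmod z = 1" "z \<noteq> 0"
      by (auto simp: space_haar_circle)
    have "cnj (z powi i) = z powi (- i)"
    proof -
      have "cnj z = inverse z"
        using z by (simp add: inverse_eq_divide complex_div_cnj[of 1])
      then show ?thesis
        by (simp add: power_int_minus power_int_inverse)
    qed
    then have "c j * z ^ j * cnj (z powi i) = c j * z powi (int j - i)" for j
      using z by (simp add: power_int_diff power_int_minus divide_inverse)
    moreover have "(\<lambda>j. c j * z ^ j * cnj (z powi i)) sums (\<phi> z * cnj (z powi i))"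
      using z by (intro sums_mult2 series) simp
    ultimately have "(\<lambda>j. c j * z powi (int j - i)) sums (\<phi> z * cnj (z powi i))"
      by (simp only:)
    then show "\<phi> z * cnj (z powi i) = (\<Sum>j. c j * z powi (int j - i))"
      by (simp add: sums_iff)
  qed simp
  also have "\<dots> = (\<Sum>j. LINT z|haar_circle. c j * z powi (int j - i))"
  proof (rule integral_suminf[OF int])
    show "AE z in haar_circle. summable (\<lambda>j. norm (c j * z powi (int j - i)))"
      using c by (intro AE_I2) (simp add: space_haar_circle norm)
    have "(LINT z|haar_circle. norm (c j * z powi (int j - i))) = cmod (c j)" for j
    proof -
      have "(LINT z|haar_circle. norm (c j * z powi (int j - i))) = (LINT z|haar_circle. cmod (c j))"
        by (intro Bochner_Integration.integral_cong) (auto simp: space_haar_circle norm)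
      then show ?thesis
        by (simp add: prob_space)
    qed
    then show "summable (\<lambda>j. LINT z|haar_circle. norm (c j * z powi (int j - i)))"
      using c by simp
  qed
  also have "\<dots> = (\<Sum>j. if int j = i then c j else 0)"
  proof -
    have "(LINT z|haar_circle. c j * z powi (int j - i)) = (if int j = i then c j else 0)" for j
      using integral_haar_circle_powi[of "int j - i"] by (simp add: prob_space)
    then show ?thesis
      by simp
  qed
  also have "\<dots> = (if 0 \<le> i then c (nat i) else 0)"
  proof (cases "0 \<le> i")
    case True
    then have "int j = i \<longleftrightarrow> j = nat i" for j
      by auto
    then show ?thesis
      using sums_single[of "nat i" c] True by (simp add: sums_iff)
  next
    case False
    then have "(\<lambda>j. if int j = i then c j else 0) = (\<lambda>j. 0)"
      by auto
    then show ?thesis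
      using False by simp
  qed
  finally show ?thesis .
qed

lemma norm_power_series_le:
  fixes c :: "nat \<Rightarrow> complex"
  assumes "summable (\<lambda>j. cmod (c j))" "cmod z \<le> 1" "(\<lambda>j. c j * z ^ j) sums s"
  shows "cmod s \<le> (\<Sum>j. cmod (c j))"
proof -
  have "cmod (c j * z ^ j) \<le> cmod (c j)" for j
    using assms(2) by (simp add: norm_mult norm_power mult_left_le power_le_one)
  then have "cmod (\<Sum>j. c j * z ^ j) \<le> (\<Sum>j. cmod (c j))"
    using assms(1) by (intro norm_suminf_le) auto
  then show ?thesis
    using assms(3) by (simp add: sums_iff)
qed

text \<open>Padded with zero exponents up to \<open>N\<close>, the character factorizes like the
  function, which leaves one-variable coefficients.\<close>

lemma fourier_coeff_prod:
  fixes c :: "nat \<Rightarrow> nat \<Rightarrow> complex"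
  assumes \<phi>: "\<And>n. \<phi> n \<in> borel_measurable borel" and c: "\<And>n. summable (\<lambda>j. cmod (c n j))"
    and series: "\<And>n z. cmod z \<le> 1 \<Longrightarrow> (\<lambda>j. c n j * z ^ j) sums \<phi> n z"
    and supp: "{n. \<gamma> n \<noteq> 0} \<subseteq> {..<N}"
  shows "fourier_coeff (\<lambda>w. \<Prod>n<N. \<phi> n (w n)) \<gamma>
    = (\<Prod>n<N. if 0 \<le> \<gamma> n then c n (nat (\<gamma> n)) else 0)"
proof -
  have powi: "(\<lambda>z. z powi m :: complex) \<in> borel_measurable borel" for m
    unfolding power_int_def by measurable
  have "(\<Prod>n | \<gamma> n \<noteq> 0. w n powi \<gamma> n) = (\<Prod>n<N. w n powi \<gamma> n)" for w :: "nat \<Rightarrow> complex"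
    using supp by (intro prod.mono_neutral_left) auto
  then have "fourier_coeff (\<lambda>w. \<Prod>n<N. \<phi> n (w n)) \<gamma>
      = (LINT w|haar_polytorus. (\<Prod>n<N. \<phi> n (w n) * cnj (w n powi \<gamma> n)))"
    by (simp add: fourier_coeff_def prod.distrib)
  also have "\<dots> = (\<Prod>n<N. LINT z|haar_circle. \<phi> n z * cnj (z powi \<gamma> n))"
  proof (rule integral_polytorus_prod)
    fix n
    show m: "(\<lambda>z. \<phi> n z * cnj (z powi \<gamma> n)) \<in> borel_measurable borel"
    proof (intro borel_measurable_times \<phi> measurable_compose[OF powi])
      show "cnj \<in> borel_measurable borel"
        by (intro borel_measurable_continuous_onI continuous_intros)
    qed
    show "integrable haar_circle (\<lambda>z. \<phi> n z * cnj (z powi \<gamma> n))"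
      using norm_power_series_le[OF c _ series]
      by (intro integrable_haar_circle_bounded[of _ "\<Sum>j. cmod (c n j)"] m)
         (auto simp: norm_mult norm_power_int)
  qed simp
  also have "\<dots> = (\<Prod>n<N. if 0 \<le> \<gamma> n then c n (nat (\<gamma> n)) else 0)"
    by (intro prod.cong refl integral_power_series_coeff \<phi> c series)
  finally show ?thesis .
qed

text \<open>A finite set of tuples lies in the box of its projections, and over a box the sum
  factorizes into one-variable sums, each bounded by its total.\<close>

lemma norm_prod_summable_on_PiE:
  fixes f :: "'a \<Rightarrow> 'b \<Rightarrow> complex"
  assumes A: "finite A" and f: "\<And>x. x \<in> A \<Longrightarrow> (\<lambda>y. norm (f x y)) summable_on B x"
  shows "(\<lambda>g. norm (\<Prod>x\<in>A. f x (g x))) summable_on (PiE A B)"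
proof (rule nonneg_bdd_above_summable_on)
  show "bdd_above (sum (\<lambda>g. norm (\<Prod>x\<in>A. f x (g x))) ` {F. F \<subseteq> PiE A B \<and> finite F})"
  proof (rule bdd_aboveI2)
    fix P assume "P \<in> {F. F \<subseteq> PiE A B \<and> finite F}"
    then have P: "P \<subseteq> PiE A B" "finite P"
      by auto
    let ?Q = "\<lambda>x. (\<lambda>g. g x) ` P"
    have "(\<Sum>g\<in>P. norm (\<Prod>x\<in>A. f x (g x))) \<le> (\<Sum>g\<in>PiE A ?Q. norm (\<Prod>x\<in>A. f x (g x)))"
      using P A by (intro sum_mono2 finite_PiE) (auto simp: PiE_iff)
    also have "\<dots> = (\<Prod>x\<in>A. \<Sum>y\<in>?Q x. norm (f x y))"
      using A P(2) by (subst prod_sum_PiE) (auto simp: prod_norm)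
    also have "\<dots> \<le> (\<Prod>x\<in>A. infsum (\<lambda>y. norm (f x y)) (B x))"
      using P f by (intro prod_mono conjI sum_nonneg finite_sum_le_infsum) (auto simp: PiE_iff)
    finally show "(\<Sum>g\<in>P. norm (\<Prod>x\<in>A. f x (g x))) \<le> (\<Prod>x\<in>A. infsum (\<lambda>y. norm (f x y)) (B x))" .
  qed
qed simp

text \<open>Multiplying out \<open>N\<close> absolutely convergent series gives a sum over tuples of
  length \<open>N\<close>. Multi-indices reaching further contribute 0 because
  \<open>z n = 0\<close> there, and \<open>c n 0 = 1\<close> allows zero exponents to be
  dropped.\<close>

lemma has_sum_monomials:
  fixes c :: "nat \<Rightarrow> nat \<Rightarrow> complex"
  assumes c: "\<And>n. summable (\<lambda>j. cmod (c n j))" and c0: "\<And>n. c n 0 = 1"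
    and series: "\<And>n z. cmod z \<le> 1 \<Longrightarrow> (\<lambda>j. c n j * z ^ j) sums \<phi> n z"
    and z: "\<And>n. cmod (z n) \<le> 1" "\<And>n. N \<le> n \<Longrightarrow> z n = 0"
  shows "((\<lambda>\<alpha>. (\<Prod>n | \<alpha> n \<noteq> 0. c n (\<alpha> n)) * (\<Prod>n | \<alpha> n \<noteq> 0. z n ^ \<alpha> n))
    has_sum (\<Prod>n<N. \<phi> n (z n))) {\<alpha>. finite {n. \<alpha> n \<noteq> 0}}"
proof -
  let ?t = "\<lambda>n j. c n j * z n ^ j"
  have le: "cmod (?t n j) \<le> cmod (c n j)" for n j
    using z(1)[of n] by (simp add: norm_mult norm_power mult_left_le power_le_one)
  have abs: "(\<lambda>j. norm (?t n j)) summable_on UNIV" for n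
  proof -
    have "summable (\<lambda>j. norm (?t n j))"
      using c[of n] by (rule summable_comparison_test') (use le in auto)
    then show ?thesis
      by (intro norm_summable_imp_summable_on) simp
  qed
  have "infsum (?t n) UNIV = \<phi> n (z n)" for n
  proof -
    have "(?t n has_sum \<phi> n (z n)) UNIV"
    proof (rule norm_summable_imp_has_sum)
      show "summable (\<lambda>j. norm (?t n j))"
        using c[of n] by (rule summable_comparison_test') (use le in auto)
    qed (rule series[OF z(1)])
    then show ?thesis
      by (rule infsumI)
  qed
  then have inf: "infsum (\<lambda>g. \<Prod>n<N. ?t n (g n)) (PiE {..<N} (\<lambda>_. UNIV)) = (\<Prod>n<N. \<phi> n (z n))"
    using infsum_prod_PiE_abs[of "{..<N}" ?t "\<lambda>_. UNIV"] abs by simp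
  have "(\<lambda>g. \<Prod>n<N. ?t n (g n)) summable_on (PiE {..<N} (\<lambda>_. UNIV))"
    by (rule abs_summable_summable[OF norm_prod_summable_on_PiE]) (simp_all only: finite_lessThan abs)
  from has_sum_infsum[OF this]
  have "((\<lambda>g. \<Prod>n<N. ?t n (g n)) has_sum (\<Prod>n<N. \<phi> n (z n))) (PiE {..<N} (\<lambda>_. UNIV))"
    by (simp only: inf)
  \<comment> \<open>Tuples are \<open>undefined\<close> outside \<open>{..<N}\<close>, multi-indices
    are 0 there; restricting and padding with 0 are inverse to each other.\<close>
  also have "?this \<longleftrightarrow> ((\<lambda>\<alpha>. \<Prod>n<N. ?t n (\<alpha> n)) has_sum (\<Prod>n<N. \<phi> n (z n))) {\<alpha>. {n. \<alpha> n \<noteq> 0} \<subseteq> {..<N}}"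
    by (rule has_sum_reindex_bij_witness[of _ "\<lambda>\<alpha>. restrict \<alpha> {..<N}" "\<lambda>g n. if n < N then g n else 0"])
       (auto simp: fun_eq_iff PiE_iff extensional_def)
  also have "\<dots> \<longleftrightarrow> ?thesis"
  proof (rule has_sum_cong_neutral)
    fix \<alpha> :: "nat \<Rightarrow> nat"
    assume "\<alpha> \<in> {\<alpha>. finite {n. \<alpha> n \<noteq> 0}} - {\<alpha>. {n. \<alpha> n \<noteq> 0} \<subseteq> {..<N}}"
    then obtain m where m: "finite {n. \<alpha> n \<noteq> 0}" "\<alpha> m \<noteq> 0" "N \<le> m"
      by (auto simp flip: not_less)
    then have "(\<Prod>n | \<alpha> n \<noteq> 0. z n ^ \<alpha> n) = 0"
      using z(2)[of m] by (intro prod_zero bexI[of _ m]) auto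
    then show "(\<Prod>n | \<alpha> n \<noteq> 0. c n (\<alpha> n)) * (\<Prod>n | \<alpha> n \<noteq> 0. z n ^ \<alpha> n) = 0"
      by simp
  next
    fix \<alpha> :: "nat \<Rightarrow> nat"
    assume "\<alpha> \<in> {\<alpha>. {n. \<alpha> n \<noteq> 0} \<subseteq> {..<N}} - {\<alpha>. finite {n. \<alpha> n \<noteq> 0}}"
    then have False
      by (auto dest: finite_subset)
    then show "(\<Prod>n<N. ?t n (\<alpha> n)) = 0" ..
  next
    fix \<alpha> :: "nat \<Rightarrow> nat"
    assume "\<alpha> \<in> {\<alpha>. {n. \<alpha> n \<noteq> 0} \<subseteq> {..<N}} \<inter> {\<alpha>. finite {n. \<alpha> n \<noteq> 0}}"
    then have "(\<Prod>n | \<alpha> n \<noteq> 0. ?t n (\<alpha> n)) = (\<Prod>n<N. ?t n (\<alpha> n))"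
      by (intro prod.mono_neutral_left) (auto simp: c0)
    then show "(\<Prod>n<N. ?t n (\<alpha> n)) = (\<Prod>n | \<alpha> n \<noteq> 0. c n (\<alpha> n)) * (\<Prod>n | \<alpha> n \<noteq> 0. z n ^ \<alpha> n)"
      by (simp add: prod.distrib)
  qed
  finally show ?thesis .
qed

section \<open>The one-variable factor\<close>

text \<open>An affine image of the Moebius map \<open>(a - z) / (1 - a * z)\<close> with a = 1 - e,
  scaled to the value 1 at the origin. For 0 < e \<le> 1 its only zero in the closed disc is the
  boundary point 1.\<close>

definition factor :: "real \<Rightarrow> complex \<Rightarrow> complex" where
  "factor e z = (1 - z) / (1 - of_real (1 - e) * z)"

lemma factor_denominator_nonzero:
  assumes "0 < e" "e \<le> 1" "cmod z \<le> 1"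
  shows "1 - of_real (1 - e) * z \<noteq> 0"
proof
  assume "1 - of_real (1 - e) * z = 0"
  then have "cmod (of_real (1 - e) * z) = 1"
    by simp
  then have "(1 - e) * cmod z = 1"
    using assms by (simp add: norm_mult del: of_real_diff)
  moreover have "(1 - e) * cmod z \<le> (1 - e) * 1"
    using assms by (intro mult_left_mono) auto
  ultimately show False
    using assms by simp
qed

lemma borel_measurable_factor [measurable]: "factor e \<in> borel_measurable borel"
  unfolding factor_def by measurable

lemma factor_eq_0_iff:
  assumes "0 < e" "e \<le> 1" "cmod z \<le> 1"
  shows "factor e z = 0 \<longleftrightarrow> z = 1"
  using factor_denominator_nonzero[OF assms] by (auto simp: factor_def)

text \<open>The function \<open>factor e\<close> maps the unit disc onto the disc with diameter \<open>[0, 2 / (2 - e)]\<close>.\<close>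

lemma factor_minus_center:
  assumes "0 < e" "e \<le> 1" "cmod z \<le> 1"
  shows "factor e z - of_real (1 / (2 - e))
    = of_real (1 / (2 - e)) * ((of_real (1 - e) - z) / (1 - of_real (1 - e) * z))"
proof -
  have "(2 - of_real e :: complex) = of_real (2 - e)"
    by simp
  then have "2 - of_real e \<noteq> (0 :: complex)"
    using assms by (simp only: of_real_eq_0_iff)
  then show ?thesis
    using factor_denominator_nonzero[OF assms]
    by (simp add: factor_def divide_simps) (simp add: algebra_simps)
qed

text \<open>For |a| \<le> 1 the right side is nonnegative on the disc and zero on the circle: the
  first bounds the image of the disc, the second locates the image of the circle.\<close>

lemma norm_moebius_diff:
  "(cmod (1 - of_real a * z))\<^sup>2 - (cmod (of_real a - z))\<^sup>2 = (1 - a\<^sup>2) * (1 - (cmod z)\<^sup>2)"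
  unfolding cmod_power2 by (simp add: power2_eq_square algebra_simps)

lemma norm_factor_minus_center_le:
  assumes "0 < e" "e \<le> 1" "cmod z \<le> 1"
  shows "cmod (factor e z - of_real (1 / (2 - e))) \<le> 1 / (2 - e)"
proof -
  have "0 \<le> (1 - (1 - e)\<^sup>2) * (1 - (cmod z)\<^sup>2)"
    using assms by (intro mult_nonneg_nonneg) (auto simp: power_le_one)
  then have "(cmod (of_real (1 - e) - z))\<^sup>2 \<le> (cmod (1 - of_real (1 - e) * z))\<^sup>2"
    using norm_moebius_diff[of "1 - e" z] by linarith
  then have "cmod (of_real (1 - e) - z) \<le> cmod (1 - of_real (1 - e) * z)"
    by (rule power2_le_imp_le) simp
  then have "cmod ((of_real (1 - e) - z) / (1 - of_real (1 - e) * z)) \<le> 1"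
    using factor_denominator_nonzero[OF assms] by (simp add: norm_divide divide_le_eq_1)
  then have "1 / (2 - e) * cmod ((of_real (1 - e) - z) / (1 - of_real (1 - e) * z)) \<le> 1 / (2 - e) * 1"
    using assms by (intro mult_left_mono) auto
  moreover have "cmod (of_real (1 / (2 - e))) = 1 / (2 - e)"
    using assms by (simp only: norm_of_real) simp
  ultimately show ?thesis
    by (simp only: factor_minus_center[OF assms] norm_mult mult_1_right)
qed

lemma norm_factor_le:
  assumes "0 < e" "e \<le> 1" "cmod z \<le> 1"
  shows "cmod (factor e z) \<le> 1 + e"
proof -
  have "cmod (factor e z) \<le> cmod (factor e z - of_real (1 / (2 - e))) + cmod (of_real (1 / (2 - e)))"
    by (metis add.commute diff_add_cancel norm_triangle_ineq)
  also have "\<dots> \<le> 1 / (2 - e) + 1 / (2 - e)"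
    using assms norm_factor_minus_center_le[OF assms] by (intro add_mono) (simp_all only: norm_of_real, simp)
  also have "\<dots> \<le> 1 + e"
  proof -
    have "e * e \<le> e * 1"
      using assms by (intro mult_left_mono) auto
    then show ?thesis
      using assms by (simp add: field_simps)
  qed
  finally show ?thesis .
qed

text \<open>On the unit circle the value lies on the boundary of that disc, which linearizes its squared norm.\<close>

lemma norm_factor_square_circle:
  assumes "0 < e" "e \<le> 1" "cmod z = 1"
  shows "(cmod (factor e z))\<^sup>2 = 2 / (2 - e) * Re (factor e z)"
proof -
  have z: "cmod z \<le> 1"
    using assms by simp
  have "(cmod (of_real (1 - e) - z))\<^sup>2 = (cmod (1 - of_real (1 - e) * z))\<^sup>2"
    using norm_moebius_diff[of "1 - e" z] assms(3) by simp
  then have "cmod (of_real (1 - e) - z) = cmod (1 - of_real (1 - e) * z)"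
    by (simp add: power2_eq_iff_nonneg)
  then have "cmod ((of_real (1 - e) - z) / (1 - of_real (1 - e) * z)) = 1"
    using factor_denominator_nonzero[OF assms(1,2) z] by (simp add: norm_divide)
  moreover have "cmod (of_real (1 / (2 - e))) = 1 / (2 - e)"
    using assms by (simp only: norm_of_real) simp
  ultimately have "cmod (factor e z - of_real (1 / (2 - e))) = 1 / (2 - e)"
    by (simp only: factor_minus_center[OF assms(1,2) z] norm_mult mult_1_right)
  then have "(cmod (factor e z - of_real (1 / (2 - e))))\<^sup>2 = (1 / (2 - e))\<^sup>2"
    by simp
  moreover have "(cmod (w - of_real t))\<^sup>2 = (cmod w)\<^sup>2 - 2 * t * Re w + t\<^sup>2" for w t
    unfolding cmod_power2 by (simp add: power2_eq_square algebra_simps)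
  ultimately have "(cmod (factor e z))\<^sup>2 - 2 * (1 / (2 - e)) * Re (factor e z) + (1 / (2 - e))\<^sup>2
      = (1 / (2 - e))\<^sup>2"
    by (simp only:)
  then show ?thesis
    by simp
qed

text \<open>As \<open>1 - z\<close> is the denominator minus \<open>e * z\<close>, the difference is
  -e z / (1 - (1 - e) z), a geometric series.\<close>

lemma factor_minus_1:
  assumes "0 < e" "e \<le> 1" "cmod z \<le> 1"
  shows "(\<lambda>j. - of_real (e * (1 - e) ^ j) * z ^ Suc j) sums (factor e z - 1)"
proof -
  let ?a = "of_real (1 - e) :: complex"
  have "cmod (?a * z) \<le> (1 - e) * 1"
    using assms by (simp only: norm_mult norm_of_real) (intro mult_mono, auto)
  then have "(\<lambda>j. (?a * z) ^ j) sums (1 / (1 - ?a * z))"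
    using assms by (intro geometric_sums) simp
  then have "(\<lambda>j. - of_real e * z * (?a * z) ^ j) sums (- of_real e * z * (1 / (1 - ?a * z)))"
    by (rule sums_mult)
  moreover have "- of_real e * z * (1 / (1 - ?a * z)) = factor e z - 1"
    using factor_denominator_nonzero[OF assms] by (simp add: factor_def field_simps)
  moreover have "- of_real e * z * (?a * z) ^ j = - of_real (e * (1 - e) ^ j) * z ^ Suc j" for j
    by (simp add: power_mult_distrib mult_ac del: of_real_diff)
  ultimately show ?thesis
    by (simp only:)
qed

text \<open>Taylor coefficients at 0 of \<open>factor e (z ^ k)\<close>. At j = k m with m \<ge> 1
  the geometric exponent is m - 1, since the series after the constant 1 starts with
  \<open>z ^ k\<close>.\<close>

definition factor_coeff :: "real \<Rightarrow> nat \<Rightarrow> nat \<Rightarrow> complex" where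
  "factor_coeff e k j =
     (if j = 0 then 1 else if k dvd j then - of_real (e * (1 - e) ^ (j div k - 1)) else 0)"

lemma factor_coeff_0 [simp]: "factor_coeff e k 0 = 1"
  by (simp add: factor_coeff_def)

lemma strict_mono_multiples: "0 < k \<Longrightarrow> strict_mono (\<lambda>j. k * Suc j)"
  by (simp add: strict_mono_Suc_iff)

lemma factor_coeff_multiple:
  "0 < k \<Longrightarrow> factor_coeff e k (k * Suc j) = - of_real (e * (1 - e) ^ j)"
  by (simp add: factor_coeff_def del: mult_Suc_right)

lemma factor_coeff_not_multiple:
  assumes "0 < k" "j \<notin> range (\<lambda>i. k * Suc i)" "j \<noteq> 0"
  shows "factor_coeff e k j = 0"
proof -
  have "\<not> k dvd j"
  proof
    assume "k dvd j"
    then obtain i where "j = k * i"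
      by blast
    with assms(3) have "j = k * Suc (i - 1)"
      by simp
    with assms(2) show False
      by blast
  qed
  then show ?thesis
    using assms(3) by (simp add: factor_coeff_def)
qed

lemma summable_factor_coeff:
  assumes "0 < e" "e \<le> 1" "0 < k"
  shows "summable (\<lambda>j. cmod (factor_coeff e k j))"
proof -
  \<comment> \<open>Index 0 is blanked out so that the support lies in the positive multiples
    \<open>k * Suc j\<close>, along which the series is geometric.\<close>
  let ?f = "\<lambda>j. if j = 0 then 0 else cmod (factor_coeff e k j)"
  have "?f (k * Suc j) = e * (1 - e) ^ j" for j
    using assms by (simp only: factor_coeff_multiple) (simp add: norm_mult norm_power del: of_real_diff)
  then have "summable (\<lambda>j. ?f (k * Suc j))"
    using assms by (simp only:) (intro summable_mult summable_geometric, simp)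
  then have "summable ?f"
    by (rule summable_mono_reindex[OF strict_mono_multiples[OF assms(3)], THEN iffD1, rotated])
       (use factor_coeff_not_multiple assms in auto)
  then show ?thesis
    by (rule summable_cong[THEN iffD1, rotated]) (auto intro!: eventually_sequentiallyI[of 1])
qed

lemma sums_factor_coeff:
  assumes "0 < e" "e \<le> 1" "0 < k" "cmod z \<le> 1"
  shows "(\<lambda>j. factor_coeff e k j * z ^ j) sums factor e (z ^ k)"
proof -
  let ?f = "\<lambda>j. if j = 0 then 0 else factor_coeff e k j * z ^ j"
  have "cmod (z ^ k) \<le> 1"
    using assms by (simp add: norm_power power_le_one)
  then have "(\<lambda>j. - of_real (e * (1 - e) ^ j) * (z ^ k) ^ Suc j) sums (factor e (z ^ k) - 1)"
    using assms by (intro factor_minus_1)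
  moreover have "?f (k * Suc j) = - of_real (e * (1 - e) ^ j) * (z ^ k) ^ Suc j" for j
    using assms by (simp only: factor_coeff_multiple power_mult) simp
  ultimately have "(\<lambda>j. ?f (k * Suc j)) sums (factor e (z ^ k) - 1)"
    by (simp only:)
  then have "?f sums (factor e (z ^ k) - 1)"
    by (rule sums_mono_reindex[OF strict_mono_multiples[OF assms(3)], THEN iffD1, rotated])
       (use factor_coeff_not_multiple assms in auto)
  then have "(\<lambda>j. ?f j + (if j = 0 then 1 else 0)) sums (factor e (z ^ k) - 1 + 1)"
    by (intro sums_add sums_single)
  moreover have "?f j + (if j = 0 then 1 else 0) = factor_coeff e k j * z ^ j" for j
    by simp
  ultimately show ?thesis
    by simp
qed

text \<open>The logarithm is taken of the reciprocal, whose values stay in the half-plane Re w \<ge>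
  1/2, where \<open>Ln\<close> is Lipschitz; \<open>factor e z\<close> itself comes arbitrarily
  close to 0 near z = 1.\<close>

definition log_factor :: "real \<Rightarrow> complex \<Rightarrow> complex" where
  "log_factor e z = - Ln ((1 - of_real (1 - e) * z) / (1 - z))"

lemma log_factor_0 [simp]: "log_factor e 0 = 0"
  by (simp add: log_factor_def)

lemma exp_log_factor:
  assumes "0 < e" "e \<le> 1" "cmod z < 1"
  shows "exp (log_factor e z) = factor e z"
proof -
  have "1 - of_real (1 - e) * z \<noteq> 0" "1 - z \<noteq> 0"
    using factor_denominator_nonzero[of e z] assms by auto
  then show ?thesis
    by (simp add: log_factor_def factor_def exp_minus)
qed

lemma Re_inverse_factor_ge:
  assumes "0 < e" "e \<le> 1" "cmod z < 1"
  shows "1 / 2 \<le> Re ((1 - of_real (1 - e) * z) / (1 - z))"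
proof -
  have z: "1 - z \<noteq> 0"
    using assms by auto
  have "Re ((1 + z) / (1 - z)) = (1 - (cmod z)\<^sup>2) / (cmod (1 - z))\<^sup>2"
    unfolding complex_div_gt_0 Re_divide cmod_power2
    by (simp add: power2_eq_square algebra_simps)
  then have "0 \<le> Re ((1 + z) / (1 - z))"
    using assms by (simp add: power_le_one)
  \<comment> \<open>The reciprocal is a convex combination of 1 and the Cayley transform
    \<open>(1 + z) / (1 - z)\<close>, whose real part is nonnegative.\<close>
  moreover have "(1 - of_real (1 - e) * z) / (1 - z)
      = of_real (1 - e / 2) + of_real (e / 2) * ((1 + z) / (1 - z))"
    using z by (simp add: field_simps)
  then have "Re ((1 - of_real (1 - e) * z) / (1 - z)) = (1 - e / 2) + e / 2 * Re ((1 + z) / (1 - z))"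
    by (simp only: plus_complex.sel times_complex.sel Re_complex_of_real Im_complex_of_real
        mult_zero_left diff_zero)
  moreover have "0 \<le> e / 2 * Re ((1 + z) / (1 - z))"
    using assms calculation(1) by (intro mult_nonneg_nonneg) auto
  ultimately show ?thesis
    using assms by linarith
qed

lemma holomorphic_on_log_factor:
  assumes "0 < e" "e \<le> 1"
  shows "log_factor e holomorphic_on ball 0 1"
  unfolding log_factor_def
proof (intro holomorphic_intros)
  fix z :: complex assume "z \<in> ball 0 1"
  then have z: "cmod z < 1"
    by simp
  then show "1 - z \<noteq> 0"
    by auto
  show "(1 - of_real (1 - e) * z) / (1 - z) \<notin> \<real>\<^sub>\<le>\<^sub>0"
    using Re_inverse_factor_ge[OF assms z] by (auto simp: complex_nonpos_Reals_iff)
qed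

text \<open>Mean value inequality on a convex set containing \<open>w\<close> and 1, where the
  derivative \<open>inverse v\<close> has modulus at most 2.\<close>

lemma norm_Ln_le_half_plane:
  assumes "1 / 2 \<le> Re w"
  shows "cmod (Ln w) \<le> 2 * cmod (w - 1)"
proof -
  have "cmod (Ln w - Ln 1) \<le> 2 * cmod (w - 1)"
  proof (rule field_differentiable_bound[of "{w. 1 / 2 \<le> Re w}"])
    show "convex {w. 1 / 2 \<le> Re w}"
      by (rule convex_halfspace_Re_ge)
    fix v assume "v \<in> {w. 1 / 2 \<le> Re w}"
    then have v: "1 / 2 \<le> Re v"
      by simp
    then have "v \<notin> \<real>\<^sub>\<le>\<^sub>0"
      by (auto simp: complex_nonpos_Reals_iff)
    then show "(Ln has_field_derivative inverse v) (at v within {w. 1 / 2 \<le> Re w})"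
      by (rule has_field_derivative_Ln[THEN has_field_derivative_at_within])
    have "1 / 2 \<le> cmod v"
      using v complex_Re_le_cmod[of v] by linarith
    then have "inverse (cmod v) \<le> inverse (1 / 2)"
      by (intro le_imp_inverse_le) auto
    then show "cmod (inverse v) \<le> 2"
      by (simp add: norm_inverse)
  qed (use assms in auto)
  then show ?thesis
    by simp
qed

text \<open>The reciprocal of the factor differs from 1 by e z / (1 - z). Linearity in
  \<open>e\<close>, uniformly for |z| \<le> r, is what makes the series of logarithms
  converge.\<close>

lemma norm_log_factor_le:
  assumes "0 < e" "e \<le> 1" "cmod z \<le> r" "r < 1"
  shows "cmod (log_factor e z) \<le> 2 / (1 - r) * e"
proof -
  have z: "cmod z < 1" "1 - z \<noteq> 0"
    using assms by auto
  have "1 - r \<le> cmod (1 - z)"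
    using assms norm_triangle_ineq2[of 1 z] by simp
  have "(1 - of_real (1 - e) * z) / (1 - z) - 1 = of_real e * z / (1 - z)"
    using z by (simp add: field_simps)
  then have "cmod (log_factor e z) \<le> 2 * cmod (of_real e * z / (1 - z))"
    using norm_Ln_le_half_plane[OF Re_inverse_factor_ge[OF assms(1,2) z(1)]]
    by (simp add: log_factor_def)
  also have "\<dots> = 2 * (e * cmod z / cmod (1 - z))"
    using assms by (simp add: norm_mult norm_divide)
  also have "\<dots> \<le> 2 * (e * 1 / (1 - r))"
    using assms z \<open>1 - r \<le> cmod (1 - z)\<close> by (intro mult_left_mono frac_le) auto
  finally show ?thesis
    by simp
qed

lemma integral_factor:
  assumes "0 < e" "e \<le> 1"
  shows "(LINT z|haar_circle. factor e z) = 1"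
proof -
  have "(\<lambda>j. factor_coeff e 1 j * z ^ j) sums factor e z" if "cmod z \<le> 1" for z
    using sums_factor_coeff[OF assms, of 1 z] that by (simp only: power_one_right)
  then have "(LINT z|haar_circle. factor e z * cnj (z powi 0)) = (if 0 \<le> (0::int) then factor_coeff e 1 (nat 0) else 0)"
    by (intro integral_power_series_coeff borel_measurable_factor summable_factor_coeff assms) simp
  then show ?thesis
    by simp
qed

lemma integrable_factor:
  assumes "0 < e" "e \<le> 1"
  shows "integrable haar_circle (factor e)"
  by (rule integrable_haar_circle_bounded[of _ "1 + e", OF borel_measurable_factor norm_factor_le[OF assms]]) simp

text \<open>On the circle the squared modulus is a multiple of the real part, whose mean is the
  value 1 at the origin; 2 / (2 - e) \<le> 1 + e follows from e^2 \<le> e.\<close>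

lemma integral_norm_factor_square_le:
  assumes "0 < e" "e \<le> 1"
  shows "(LINT z|haar_circle. (cmod (factor e z))\<^sup>2) \<le> 1 + e"
proof -
  have "(LINT z|haar_circle. (cmod (factor e z))\<^sup>2) = (LINT z|haar_circle. 2 / (2 - e) * Re (factor e z))"
    by (intro Bochner_Integration.integral_cong) (auto simp: space_haar_circle norm_factor_square_circle assms)
  also have "\<dots> = 2 / (2 - e) * Re (LINT z|haar_circle. factor e z)"
    using integrable_factor[OF assms] by simp
  also have "\<dots> \<le> 1 + e"
  proof -
    have "e * e \<le> e * 1"
      using assms by (intro mult_left_mono) auto
    then show ?thesis
      using assms by (simp add: integral_factor field_simps)
  qed
  finally show ?thesis .
qed

section \<open>Holomorphic functions on the ball of \<open>c\<^sub>0\<close>\<close>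

lemma norm_le_c0_norm:
  assumes "h \<in> c0"
  shows "cmod (h n) \<le> c0_norm h"
proof -
  have "Bseq h"
    using assms by (auto simp: c0_def intro: convergent_imp_Bseq convergentI)
  then obtain K where "\<And>n. cmod (h n) \<le> K"
    unfolding Bseq_def by blast
  then have "bdd_above (range (\<lambda>n. cmod (h n)))"
    by (auto intro!: bdd_aboveI2)
  then show ?thesis
    unfolding c0_norm_def by (rule cSUP_upper[rotated]) simp
qed

lemma c0_norm_nonneg: "h \<in> c0 \<Longrightarrow> 0 \<le> c0_norm h"
  using norm_le_c0_norm[of h 0] norm_ge_zero[of "h 0"] by linarith

text \<open>All but finitely many coordinates are below 1/2 in modulus, so bounds below 1 become a
  common one. Estimates on |z| \<le> r thus apply to all coordinates at once.\<close>

lemma c0_ball_uniform_bound: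
  assumes "z \<in> c0_ball"
  obtains r where "0 \<le> r" "r < 1" "\<And>n. cmod (z n) \<le> r"
proof -
  have z: "z \<longlonglongrightarrow> 0" "\<And>n. cmod (z n) < 1"
    using assms by (auto simp: c0_ball_def c0_def)
  from z(1) have "\<forall>\<^sub>F n in sequentially. dist (z n) 0 < 1 / 2"
    by (rule tendstoD) simp
  then obtain N where N: "\<And>n. N \<le> n \<Longrightarrow> cmod (z n) < 1 / 2"
    by (auto simp: eventually_sequentially)
  define r where "r = Max (insert (1 / 2) ((\<lambda>n. cmod (z n)) ` {..<N}))"
  have le: "x \<le> r" if "x \<in> insert (1 / 2) ((\<lambda>n. cmod (z n)) ` {..<N})" for x
    unfolding r_def using that by (intro Max_ge) auto
  have "r \<in> insert (1 / 2) ((\<lambda>n. cmod (z n)) ` {..<N})"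
    unfolding r_def by (intro Max_in) auto
  then have "r < 1"
    using z(2) by auto
  moreover have "0 \<le> r"
    using le[of "1 / 2"] by simp
  moreover have "cmod (z n) \<le> r" for n
  proof (cases "n < N")
    case False
    then show ?thesis
      using N[of n] le[of "1 / 2"] by simp
  qed (auto intro: le)
  ultimately show ?thesis
    using that by blast
qed

text \<open>The radii r, (1 + 2r)/3 and (2 + r)/3 cut [r, 1] into three equal steps: one for the
  increment in the Taylor estimate, one for the Cauchy disc, one keeping that disc away from the
  unit circle.\<close>

lemma norm_higher_deriv_le_unit_ball:
  assumes g: "g holomorphic_on ball 0 1" and r: "r < 1"
    and M: "\<And>w. cmod w \<le> (2 + r) / 3 \<Longrightarrow> cmod (g w) < M"
    and w: "cmod w \<le> (1 + 2 * r) / 3" and n: "0 < n"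
  shows "cmod ((deriv ^^ n) g w) \<le> fact n * M / ((1 - r) / 3) ^ n"
proof (rule Cauchy_higher_deriv_bound)
  have le: "cmod v \<le> (2 + r) / 3" if "dist w v \<le> (1 - r) / 3" for v
  proof -
    have "cmod v \<le> cmod w + dist w v"
      using norm_triangle_ineq4[of w "w - v"] by (simp add: dist_norm)
    then show ?thesis
      using w that r by (simp add: field_simps)
  qed
  have sub: "cball w ((1 - r) / 3) \<subseteq> ball 0 1"
    using le r by fastforce
  then show "g holomorphic_on ball w ((1 - r) / 3)"
    using g ball_subset_cball by (blast intro: holomorphic_on_subset)
  show "continuous_on (cball w ((1 - r) / 3)) g"
    using sub g by (blast intro: holomorphic_on_imp_continuous_on holomorphic_on_subset)
  show "g v \<in> ball 0 M" if "v \<in> ball w ((1 - r) / 3)" for v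
    using M[OF le, of v] that by simp
qed (use r n in auto)

lemma norm_deriv_le_unit_ball:
  assumes g: "g holomorphic_on ball 0 1" and r: "r < 1"
    and M: "\<And>w. cmod w \<le> (2 + r) / 3 \<Longrightarrow> cmod (g w) < M" and z: "cmod z \<le> r"
  shows "cmod (deriv g z) \<le> M / ((1 - r) / 3)"
  using norm_higher_deriv_le_unit_ball[OF g r M, of z 1] z r by simp

lemma second_order_remainder_unit_ball:
  assumes g: "g holomorphic_on ball 0 1" and r: "r < 1"
    and M: "\<And>w. cmod w \<le> (2 + r) / 3 \<Longrightarrow> cmod (g w) < M" and z: "cmod z \<le> r"
    and h: "cmod h \<le> (1 - r) / 3"
  shows "cmod (g (z + h) - g z - deriv g z * h) \<le> 2 * M / ((1 - r) / 3)\<^sup>2 * (cmod h)\<^sup>2"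
proof -
  let ?S = "cball z ((1 - r) / 3)"
  have le: "cmod w \<le> (1 + 2 * r) / 3" if "w \<in> ?S" for w
  proof -
    have "cmod w \<le> cmod z + dist z w"
      using norm_triangle_ineq4[of z "z - w"] by (simp add: dist_norm)
    then show ?thesis
      using z that r by (simp add: field_simps)
  qed
  have "cmod ((deriv ^^ 0) g (z + h) - (\<Sum>i\<le>1. (deriv ^^ i) g z * (z + h - z) ^ i / fact i))
      \<le> fact 2 * M / ((1 - r) / 3) ^ 2 * cmod (z + h - z) ^ Suc 1 / fact 1"
  proof (rule complex_Taylor[where S = ?S])
    fix i w assume w: "w \<in> ?S"
    have "w \<in> ball 0 1"
      using le[OF w] r by simp
    then have "((deriv ^^ i) g has_field_derivative deriv ((deriv ^^ i) g) w) (at w)"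
      using holomorphic_higher_deriv[OF g open_ball, of i] by (intro holomorphic_derivI) auto
    then show "((deriv ^^ i) g has_field_derivative (deriv ^^ Suc i) g w) (at w within ?S)"
      by (simp add: has_field_derivative_at_within)
  next
    fix w assume "w \<in> ?S"
    then show "cmod ((deriv ^^ Suc 1) g w) \<le> fact 2 * M / ((1 - r) / 3) ^ 2"
      using norm_higher_deriv_le_unit_ball[OF g r M le, of w 2] by (simp add: numeral_2_eq_2)
  qed (use h r in \<open>auto simp: dist_norm\<close>)
  then show ?thesis
    by (simp add: diff_diff_eq power2_eq_square)
qed

text \<open>Taylor estimates in each coordinate, with constants proportional to \<open>d n\<close>,
  add up: the inner sum has a bounded linear derivative, given by the coordinate derivatives, and a
  remainder quadratic in \<open>c0_norm h\<close>. The chain rule for \<open>exp\<close> is then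
  carried out by hand.\<close>

lemma holomorphic_on_c0_ball_exp_suminf:
  assumes g: "\<And>n. g n holomorphic_on ball 0 1"
    and bound: "\<And>r. r < 1 \<Longrightarrow> \<exists>C. \<forall>n z. cmod z \<le> r \<longrightarrow> cmod (g n z) \<le> C * d n"
    and d: "\<And>n. 0 < d n" "summable d"
  shows "holomorphic_on_c0_ball (\<lambda>z. exp (\<Sum>n. g n (z n)))"
  unfolding holomorphic_on_c0_ball_def
proof
  fix z assume z: "z \<in> c0_ball"
  then obtain r where r: "0 \<le> r" "r < 1" and zr: "\<And>n. cmod (z n) \<le> r"
    using c0_ball_uniform_bound by blast
  from r have "(2 + r) / 3 < 1"
    by simp
  from bound[OF this] obtain C where
    C: "\<And>n w. cmod w \<le> (2 + r) / 3 \<Longrightarrow> cmod (g n w) \<le> C * d n"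
    by blast
  let ?\<rho> = "(1 - r) / 3"
  \<comment> \<open>\<open>C + 1\<close> instead of \<open>C\<close>, because the Cauchy estimates
    ask for a strict bound.\<close>
  let ?M = "\<lambda>n. (C + 1) * d n"
  have \<rho>: "0 < ?\<rho>"
    using r by simp
  have M: "cmod (g n w) < ?M n" if "cmod w \<le> (2 + r) / 3" for n w
    using C[OF that, of n] d(1)[of n] by (simp add: distrib_right)
  have M0: "0 \<le> ?M n" for n
  proof -
    have "cmod (g n 0) < ?M n"
      using M r by simp
    then show ?thesis
      using norm_ge_zero[of "g n 0"] by linarith
  qed
  have sM: "summable (\<lambda>n. a * ?M n)" for a
    using d(2) by (intro summable_mult)
  define g' where "g' n = deriv (g n) (z n)" for n
  define K1 where "K1 = (\<Sum>n. 1 / ?\<rho> * ?M n)"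
  define K2 where "K2 = (\<Sum>n. 2 / ?\<rho>\<^sup>2 * ?M n)"
  have K: "0 \<le> K1" "0 \<le> K2"
    unfolding K1_def K2_def using r by (intro suminf_nonneg sM mult_nonneg_nonneg[OF _ M0]; simp)+
  have g'_le: "cmod (g' n * h n) \<le> 1 / ?\<rho> * ?M n * c0_norm h" if "h \<in> c0" for h n
  proof -
    have "cmod (g' n) \<le> ?M n / ?\<rho>"
      unfolding g'_def by (rule norm_deriv_le_unit_ball[OF g r(2) M zr])
    then have "cmod (g' n) * cmod (h n) \<le> (?M n / ?\<rho>) * c0_norm h"
      using norm_le_c0_norm[OF that, of n] M0[of n] \<rho> by (intro mult_mono) auto
    then show ?thesis
      by (simp add: norm_mult mult_ac)
  qed
  have sg': "summable (\<lambda>n. g' n * h n)" if "h \<in> c0" for h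
    by (rule summable_comparison_test'[OF summable_mult2[OF sM]]) (rule g'_le[OF that])
  have sum_g': "cmod (\<Sum>n. g' n * h n) \<le> K1 * c0_norm h" if "h \<in> c0" for h
    unfolding K1_def suminf_mult2[OF sM]
    by (rule norm_suminf_le[OF g'_le[OF that] summable_mult2[OF sM]])
  define S where "S w = (\<Sum>n. g n (w n))" for w
  define L where "L h = exp (S z) * (\<Sum>n. g' n * h n)" for h
  have sg: "summable (\<lambda>n. g n (w n))" if "\<And>n. cmod (w n) \<le> (2 + r) / 3" for w
    by (rule summable_comparison_test'[OF sM[of 1]]) (use M[OF that] in \<open>simp add: less_imp_le\<close>)
  have rem: "cmod (S (\<lambda>n. z n + h n) - S z - (\<Sum>n. g' n * h n)) \<le> K2 * (c0_norm h)\<^sup>2"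
    if h: "h \<in> c0" "c0_norm h \<le> ?\<rho>" for h
  proof -
    have hn: "cmod (h n) \<le> ?\<rho>" for n
      using norm_le_c0_norm[OF h(1), of n] h(2) by linarith
    have zh: "cmod (z n + h n) \<le> (2 + r) / 3" for n
      using norm_triangle_ineq[of "z n" "h n"] hn[of n] zr[of n] r by (simp add: field_simps)
    have zn: "cmod (z n) \<le> (2 + r) / 3" for n
      using zr[of n] r by simp
    have "S (\<lambda>n. z n + h n) - S z - (\<Sum>n. g' n * h n)
        = (\<Sum>n. g n (z n + h n) - g n (z n) - g' n * h n)"
      unfolding S_def using sg[OF zh] sg[OF zn] sg'[OF h(1)]
      by (simp add: suminf_diff summable_diff)
    also have "cmod \<dots> \<le> (\<Sum>n. 2 / ?\<rho>\<^sup>2 * ?M n * (c0_norm h)\<^sup>2)"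
    proof (rule norm_suminf_le[OF _ summable_mult2[OF sM]])
      fix n
      have "cmod (g n (z n + h n) - g n (z n) - g' n * h n) \<le> 2 * ?M n / ?\<rho>\<^sup>2 * (cmod (h n))\<^sup>2"
        unfolding g'_def by (rule second_order_remainder_unit_ball[OF g r(2) M zr hn])
      also have "\<dots> \<le> 2 * ?M n / ?\<rho>\<^sup>2 * (c0_norm h)\<^sup>2"
        using norm_le_c0_norm[OF h(1), of n] M0[of n]
        by (intro mult_left_mono power_mono) auto
      finally show "cmod (g n (z n + h n) - g n (z n) - g' n * h n) \<le> 2 / ?\<rho>\<^sup>2 * ?M n * (c0_norm h)\<^sup>2"
        by (simp only: times_divide_eq_left)
    qed
    also have "\<dots> = K2 * (c0_norm h)\<^sup>2"
      unfolding K2_def by (rule suminf_mult2[OF sM, symmetric])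
    finally show ?thesis .
  qed
  have "L \<in> c0_dual"
    unfolding c0_dual_def
  proof (intro CollectI conjI ballI allI)
    fix h k a b assume h: "h \<in> c0" and k: "k \<in> c0"
    have "(\<Sum>n. g' n * (a * h n + b * k n)) = (\<Sum>n. a * (g' n * h n) + b * (g' n * k n))"
      by (simp add: algebra_simps)
    also have "\<dots> = a * (\<Sum>n. g' n * h n) + b * (\<Sum>n. g' n * k n)"
      using sg'[OF h] sg'[OF k] by (simp add: suminf_add[symmetric] suminf_mult summable_mult)
    finally show "L (\<lambda>n. a * h n + b * k n) = a * L h + b * L k"
      by (simp add: L_def algebra_simps)
  next
    show "\<exists>K. \<forall>h\<in>c0. cmod (L h) \<le> K * c0_norm h"
    proof (intro exI[of _ "cmod (exp (S z)) * K1"] ballI)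
      fix h assume "h \<in> c0"
      then show "cmod (L h) \<le> cmod (exp (S z)) * K1 * c0_norm h"
        using sum_g'[of h] unfolding L_def norm_mult mult.assoc by (intro mult_left_mono) auto
    qed
  qed
  moreover have "\<forall>e>0. \<exists>d>0. \<forall>h\<in>c0. c0_norm h < d \<and> (\<lambda>n. z n + h n) \<in> c0_ball \<longrightarrow>
      cmod (exp (S (\<lambda>n. z n + h n)) - exp (S z) - L h) \<le> e * c0_norm h"
  proof (intro allI impI)
    fix e :: real assume e: "0 < e"
    \<comment> \<open>\<open>A\<close> bounds the increment of the inner sum relative to
      \<open>c0_norm h\<close>, \<open>B\<close> its quadratic remainder after multiplication by the
      exponential; the 1 makes both positive.\<close>
    define A where "A = K1 + K2 + 1"
    define B where "B = cmod (exp (S z)) * K2 + 1"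
    have AB: "0 < A" "0 < B"
      unfolding A_def B_def using K by (auto intro!: add_nonneg_pos mult_nonneg_nonneg)
    have "(exp has_derivative (*) (exp (S z))) (at (S z))"
      using DERIV_exp[of "S z"] by (simp add: has_field_derivative_def)
    then obtain d1 where d1: "0 < d1" and
      exp: "\<And>y. cmod (y - S z) < d1 \<Longrightarrow>
        cmod (exp y - exp (S z) - exp (S z) * (y - S z)) \<le> e / (2 * A) * cmod (y - S z)"
      using e AB unfolding has_derivative_at_alt by (metis divide_pos_pos mult_pos_pos zero_less_numeral)
    \<comment> \<open>In this order: the range of the remainder estimate,
      \<open>?N\<^sup>2 \<le> ?N\<close>, the range where \<open>exp\<close> is linearized, and a
      quadratic term within half of the allowed error.\<close>
    let ?d = "min (min ?\<rho> 1) (min (d1 / A) (e / (2 * B)))"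
    have "cmod (exp (S (\<lambda>n. z n + h n)) - exp (S z) - L h) \<le> e * c0_norm h"
      if h: "h \<in> c0" "c0_norm h < ?d" for h
    proof -
      let ?N = "c0_norm h" and ?s = "\<Sum>n. g' n * h n"
      define t where "t = S (\<lambda>n. z n + h n) - S z"
      have N: "0 \<le> ?N" "?N \<le> ?\<rho>" "?N \<le> 1" "A * ?N < d1" "B * ?N \<le> e / 2"
        using h AB c0_norm_nonneg[OF h(1)] by (auto simp: field_simps)
      have ts: "cmod (t - ?s) \<le> K2 * ?N\<^sup>2"
        unfolding t_def by (rule rem[OF h(1) N(2)])
      have "?N\<^sup>2 \<le> ?N"
        using N by (simp add: power2_eq_square mult_left_le)
      then have "K2 * ?N\<^sup>2 \<le> K2 * ?N"
        using K by (intro mult_left_mono)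
      moreover have "cmod t \<le> cmod ?s + cmod (t - ?s)"
        by (metis add.commute diff_add_cancel norm_triangle_ineq)
      ultimately have tA: "cmod t \<le> A * ?N"
        using ts sum_g'[OF h(1)] N(1) unfolding A_def distrib_right by linarith
      have "cmod (exp (S z + t) - exp (S z) - exp (S z) * t) \<le> e / (2 * A) * cmod t"
        using exp[of "S z + t"] tA N(4) by simp
      also have "\<dots> \<le> e / (2 * A) * (A * ?N)"
        using tA e AB by (intro mult_left_mono) auto
      also have "\<dots> = e / 2 * ?N"
        using AB by simp
      finally have 1: "cmod (exp (S z + t) - exp (S z) - exp (S z) * t) \<le> e / 2 * ?N" .
      have "cmod (exp (S z) * (t - ?s)) \<le> cmod (exp (S z)) * (K2 * ?N\<^sup>2)"
        unfolding norm_mult using ts by (rule mult_left_mono) simp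
      also have "\<dots> \<le> B * ?N * ?N"
        using N(1) by (simp add: B_def power2_eq_square algebra_simps)
      also have "\<dots> \<le> e / 2 * ?N"
        using N by (intro mult_right_mono) auto
      finally have 2: "cmod (exp (S z) * (t - ?s)) \<le> e / 2 * ?N" .
      have "exp (S (\<lambda>n. z n + h n)) - exp (S z) - L h
          = (exp (S z + t) - exp (S z) - exp (S z) * t) + exp (S z) * (t - ?s)"
        by (simp add: t_def L_def algebra_simps)
      moreover have "e / 2 * ?N + e / 2 * ?N = e * ?N"
        by (simp add: field_simps)
      ultimately show ?thesis
        using norm_triangle_mono[OF 1 2] by (simp only:)
    qed
    moreover have "0 < ?d"
      using \<rho> d1 AB e by simp
    ultimately show "\<exists>d>0. \<forall>h\<in>c0. c0_norm h < d \<and> (\<lambda>n. z n + h n) \<in> c0_ball \<longrightarrow>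
        cmod (exp (S (\<lambda>n. z n + h n)) - exp (S z) - L h) \<le> e * c0_norm h"
      by blast
  qed
  ultimately show "\<exists>L\<in>c0_dual. \<forall>e>0. \<exists>d>0. \<forall>h\<in>c0.
        c0_norm h < d \<and> (\<lambda>n. z n + h n) \<in> c0_ball \<longrightarrow>
        cmod (exp (\<Sum>n. g n (z n + h n)) - exp (\<Sum>n. g n (z n)) - L h) \<le> e * c0_norm h"
    unfolding S_def by blast
qed

section \<open>Products of factors\<close>

text \<open>By monotone convergence the sum has a finite integral, so it is finite almost
  everywhere. Used for the deviations of the block products from 1 and for the block minima.\<close>

lemma AE_summable_of_integrals:
  fixes f :: "nat \<Rightarrow> 'a \<Rightarrow> real"
  assumes f: "\<And>b. integrable M (f b)" "\<And>b x. 0 \<le> f b x"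
    and c: "\<And>b. (LINT x|M. f b x) \<le> c b" "summable c"
  shows "AE x in M. summable (\<lambda>b. f b x)"
proof -
  have [measurable]: "f b \<in> borel_measurable M" for b
    using f(1) by (rule borel_measurable_integrable)
  have c0: "0 \<le> c b" for b
    using c(1)[of b] Bochner_Integration.integral_nonneg[of M "f b"] f(2) by (meson order_trans)
  have "(\<integral>\<^sup>+x. (\<Sum>b. ennreal (f b x)) \<partial>M) = (\<Sum>b. \<integral>\<^sup>+x. ennreal (f b x) \<partial>M)"
    by (rule nn_integral_suminf) measurable
  also have "\<dots> \<le> (\<Sum>b. ennreal (c b))"
  proof (intro suminf_le summableI)
    fix b
    have "(\<integral>\<^sup>+x. ennreal (f b x) \<partial>M) = ennreal (LINT x|M. f b x)"
      using f by (intro nn_integral_eq_integral) auto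
    then show "(\<integral>\<^sup>+x. ennreal (f b x) \<partial>M) \<le> ennreal (c b)"
      using c(1)[of b] by (simp add: ennreal_leI)
  qed
  also have "\<dots> = ennreal (\<Sum>b. c b)"
    using c0 c(2) by (rule suminf_ennreal2)
  also have "\<dots> < \<infinity>"
    by simp
  finally have "AE x in M. (\<Sum>b. ennreal (f b x)) \<noteq> \<infinity>"
    by (intro nn_integral_PInf_AE) auto
  then show ?thesis
    by eventually_elim (use f(2) in \<open>auto intro: summable_suminf_not_top\<close>)
qed

lemma prod_one_plus_le_exp_sum:
  fixes d :: "'a \<Rightarrow> real"
  assumes "\<And>n. n \<in> J \<Longrightarrow> 0 \<le> d n"
  shows "(\<Prod>n\<in>J. 1 + d n) \<le> exp (\<Sum>n\<in>J. d n)"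
proof (cases "finite J")
  case True
  have "(\<Prod>n\<in>J. 1 + d n) \<le> (\<Prod>n\<in>J. exp (d n))"
    using assms by (intro prod_mono) (auto simp: add_nonneg_nonneg)
  then show ?thesis
    using True by (simp add: exp_sum)
qed simp

locale factor_product =
  fixes e :: "nat \<Rightarrow> real" and k :: "nat \<Rightarrow> nat"
  assumes e_pos: "0 < e n" and e_le_1: "e n \<le> 1" and k_pos: "0 < k n" and summable_e: "summable e"
begin

definition factors :: "nat \<Rightarrow> complex \<Rightarrow> complex" where
  "factors n z = factor (e n) (z ^ k n)"

text \<open>Logarithms instead of an infinite product reduce holomorphy and boundedness to
  absolutely convergent series.\<close>

definition extension :: "(nat \<Rightarrow> complex) \<Rightarrow> complex" where
  "extension z = exp (\<Sum>n. log_factor (e n) (z n ^ k n))"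

lemma norm_power_k_le: "cmod z \<le> r \<Longrightarrow> r \<le> 1 \<Longrightarrow> cmod (z ^ k n) \<le> r"
proof -
  assume z: "cmod z \<le> r" "r \<le> 1"
  have "cmod z ^ k n \<le> cmod z ^ 1"
    using z k_pos[of n] by (intro power_decreasing) auto
  then show ?thesis
    using z by (simp add: norm_power)
qed

lemma borel_measurable_factors [measurable]: "factors n \<in> borel_measurable borel"
  unfolding factors_def by measurable

lemma norm_factors_le: "cmod z \<le> 1 \<Longrightarrow> cmod (factors n z) \<le> 1 + e n"
  unfolding factors_def using norm_power_k_le[of z 1 n] by (intro norm_factor_le e_pos e_le_1) auto

lemma norm_prod_factors_le:
  assumes "\<And>n. n \<in> J \<Longrightarrow> cmod (z n) \<le> 1"
  shows "cmod (\<Prod>n\<in>J. factors n (z n)) \<le> exp (\<Sum>n\<in>J. e n)"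
proof -
  have "cmod (\<Prod>n\<in>J. factors n (z n)) \<le> (\<Prod>n\<in>J. 1 + e n)"
    unfolding prod_norm[symmetric] using assms norm_factors_le by (intro prod_mono) auto
  also have "\<dots> \<le> exp (\<Sum>n\<in>J. e n)"
    using e_pos by (intro prod_one_plus_le_exp_sum) (simp add: less_imp_le)
  finally show ?thesis .
qed

section \<open>Holomorphy and boundedness of the product on the ball of \<open>c0\<close>\<close>

lemma holomorphic_extension: "holomorphic_on_c0_ball extension"
  unfolding extension_def
proof (rule holomorphic_on_c0_ball_exp_suminf[where d = e])
  fix n
  have "(log_factor (e n) \<circ> (\<lambda>z. z ^ k n)) holomorphic_on ball 0 1"
    using k_pos[of n]
    by (intro holomorphic_on_compose_gen[OF _ holomorphic_on_log_factor[OF e_pos e_le_1]] holomorphic_intros)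
       (auto simp: dist_norm norm_power power_less_one_iff)
  then show "(\<lambda>z. log_factor (e n) (z ^ k n)) holomorphic_on ball 0 1"
    by (simp add: o_def)
next
  fix r :: real assume r: "r < 1"
  show "\<exists>C. \<forall>n z. cmod z \<le> r \<longrightarrow> cmod (log_factor (e n) (z ^ k n)) \<le> C * e n"
    using r by (intro exI[of _ "2 / (1 - r)"] allI impI norm_log_factor_le e_pos e_le_1 norm_power_k_le) auto
qed (auto intro: e_pos summable_e)

text \<open>\<open>log_factor\<close> vanishes at 0 and the exponents are positive, so zero
  coordinates drop out. This serves both the monomial expansion and the evaluation at the
  radii.\<close>

lemma extension_finite_support:
  assumes z: "\<And>n. cmod (z n) < 1" "\<And>n. N \<le> n \<Longrightarrow> z n = 0"
  shows "extension z = (\<Prod>n<N. factors n (z n))"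
proof -
  have "(\<Sum>n. log_factor (e n) (z n ^ k n)) = (\<Sum>n<N. log_factor (e n) (z n ^ k n))"
    using z(2) by (intro suminf_finite) (auto simp: zero_power[OF k_pos])
  moreover have "exp (log_factor (e n) (z n ^ k n)) = factors n (z n)" for n
    unfolding factors_def using z(1)[of n] k_pos[of n]
    by (intro exp_log_factor e_pos e_le_1) (simp add: norm_power power_less_one_iff)
  ultimately show ?thesis
    by (simp add: extension_def exp_sum)
qed

text \<open>The real part of each logarithm is the logarithm of a modulus at most
  \<open>1 + e n\<close>, hence at most \<open>e n\<close>, and these bounds are summable.\<close>

lemma norm_extension_le:
  assumes z: "z \<in> c0_ball"
  shows "cmod (extension z) \<le> exp (\<Sum>n. e n)"
proof -
  obtain r where r: "0 \<le> r" "r < 1" and zr: "\<And>n. cmod (z n) \<le> r"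
    using c0_ball_uniform_bound[OF z] by blast
  have zk: "cmod (z n ^ k n) \<le> r" for n
    using zr r by (intro norm_power_k_le) auto
  have sum: "summable (\<lambda>n. log_factor (e n) (z n ^ k n))"
    using summable_mult[OF summable_e, of "2 / (1 - r)"]
    by (rule summable_comparison_test') (intro norm_log_factor_le e_pos e_le_1 zk r)
  have Re: "Re (log_factor (e n) (z n ^ k n)) \<le> e n" for n
  proof -
    have "exp (Re (log_factor (e n) (z n ^ k n))) = cmod (factor (e n) (z n ^ k n))"
      using exp_log_factor[OF e_pos e_le_1, of "z n ^ k n" n] zk[of n] r
      by (simp flip: norm_exp_eq_Re)
    also have "\<dots> \<le> 1 + e n"
      using zk[of n] r by (intro norm_factor_le e_pos e_le_1) simp
    also have "\<dots> \<le> exp (e n)"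
      by (rule exp_ge_add_one_self)
    finally show ?thesis
      by simp
  qed
  have "Re (\<Sum>n. log_factor (e n) (z n ^ k n)) = (\<Sum>n. Re (log_factor (e n) (z n ^ k n)))"
    using sum by (rule Re_suminf)
  also have "\<dots> \<le> (\<Sum>n. e n)"
    using Re summable_Re[OF sum] summable_e by (rule suminf_le)
  finally show ?thesis
    by (simp add: extension_def norm_exp_eq_Re)
qed

section \<open>First and second moments of finite products\<close>

lemma integral_factors: "(LINT z|haar_circle. factors n z) = 1"
  unfolding factors_def
  by (simp add: integral_haar_circle_power[OF k_pos borel_measurable_factor] integral_factor e_pos e_le_1)

lemma integral_norm_factors_square_le: "(LINT z|haar_circle. (cmod (factors n z))\<^sup>2) \<le> 1 + e n"
proof -
  have "(\<lambda>z. (cmod (factor (e n) z))\<^sup>2) \<in> borel_measurable borel"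
    by measurable
  from integral_haar_circle_power[OF k_pos this]
  show ?thesis
    unfolding factors_def using integral_norm_factor_square_le[OF e_pos e_le_1] by simp
qed

lemma integrable_factors: "integrable haar_circle (factors n)"
  by (rule integrable_haar_circle_bounded[OF borel_measurable_factors norm_factors_le]) simp

lemma integrable_norm_factors_square: "integrable haar_circle (\<lambda>z. (cmod (factors n z))\<^sup>2)"
proof (rule integrable_haar_circle_bounded)
  show "norm ((cmod (factors n z))\<^sup>2) \<le> (1 + e n)\<^sup>2" if "cmod z = 1" for z
    using norm_factors_le[of z n] that by (simp add: power_mono)
qed measurable

lemma borel_measurable_prod_factors [measurable]:
  "(\<lambda>w. \<Prod>n\<in>J. factors n (w n)) \<in> borel_measurable haar_polytorus"
  by (intro borel_measurable_prod borel_measurable_polytorus_coordinate borel_measurable_factors)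

lemma AE_polytorus_norm: "AE w in haar_polytorus. \<forall>n. cmod (w n) = 1"
  by (rule AE_I2) (simp add: space_haar_polytorus)

lemma integrable_prod_factors: "integrable haar_polytorus (\<lambda>w. \<Prod>n\<in>J. factors n (w n))"
proof -
  interpret prob_space haar_polytorus
    by (rule prob_space_haar_polytorus)
  show ?thesis
  proof (rule integrable_const_bound)
    show "AE w in haar_polytorus. cmod (\<Prod>n\<in>J. factors n (w n)) \<le> exp (\<Sum>n\<in>J. e n)"
      using AE_polytorus_norm by eventually_elim (simp add: norm_prod_factors_le)
  qed measurable
qed

text \<open>The product has mean 1, so its mean squared distance from 1 is its mean square minus 1;
  by independence the mean square is a product of terms at most \<open>1 + e n\<close>.\<close>

lemma integral_prod_factors_minus_1:
  assumes J: "finite J"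
  shows "integrable haar_polytorus (\<lambda>w. (cmod ((\<Prod>n\<in>J. factors n (w n)) - 1))\<^sup>2)"
    and "(LINT w|haar_polytorus. (cmod ((\<Prod>n\<in>J. factors n (w n)) - 1))\<^sup>2) \<le> exp (\<Sum>n\<in>J. e n) - 1"
proof -
  interpret prob_space haar_polytorus
    by (rule prob_space_haar_polytorus)
  let ?P = "\<lambda>w. \<Prod>n\<in>J. factors n (w n)"
  have int2: "integrable haar_polytorus (\<lambda>w. (cmod (?P w))\<^sup>2)"
  proof (rule integrable_const_bound)
    show "AE w in haar_polytorus. norm ((cmod (?P w))\<^sup>2) \<le> (exp (\<Sum>n\<in>J. e n))\<^sup>2"
      using AE_polytorus_norm by eventually_elim (simp add: norm_prod_factors_le power_mono)
  qed measurable
  have split: "(cmod (x - 1))\<^sup>2 = (cmod x)\<^sup>2 - 2 * Re x + 1" for x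
    unfolding cmod_power2 by (simp add: power2_eq_square algebra_simps)
  show "integrable haar_polytorus (\<lambda>w. (cmod (?P w - 1))\<^sup>2)"
    unfolding split using int2 integrable_prod_factors[of J] by simp
  have "(LINT w|haar_polytorus. (cmod (?P w - 1))\<^sup>2)
      = (LINT w|haar_polytorus. (cmod (?P w))\<^sup>2) - 2 * Re (LINT w|haar_polytorus. ?P w) + 1"
    unfolding split using int2 integrable_prod_factors[of J] by (simp add: prob_space)
  also have "(LINT w|haar_polytorus. ?P w) = 1"
    by (subst integral_polytorus_prod) (auto simp: J integrable_factors integral_factors)
  also have "(LINT w|haar_polytorus. (cmod (?P w))\<^sup>2) = (LINT w|haar_polytorus. (\<Prod>n\<in>J. (cmod (factors n (w n)))\<^sup>2))"
    by (simp add: prod_norm[symmetric] prod_power_distrib)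
  also have "\<dots> = (\<Prod>n\<in>J. LINT z|haar_circle. (cmod (factors n z))\<^sup>2)"
    by (rule integral_polytorus_prod[OF J _ integrable_norm_factors_square]) measurable
  also have "\<dots> \<le> (\<Prod>n\<in>J. 1 + e n)"
    by (intro prod_mono conjI integral_norm_factors_square_le) simp
  also have "\<dots> \<le> exp (\<Sum>n\<in>J. e n)"
    using e_pos by (intro prod_one_plus_le_exp_sum) (simp add: less_imp_le)
  finally show "(LINT w|haar_polytorus. (cmod (?P w - 1))\<^sup>2) \<le> exp (\<Sum>n\<in>J. e n) - 1"
    by simp
qed

end

section \<open>The boundary function\<close>

lemma AE_haar_circle_neq_1: "AE z in haar_circle. z \<noteq> 1"
proof -
  have "cis t \<noteq> 1" if t: "t \<in> {0..<2 * pi}" "t \<noteq> 0" for t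
  proof
    assume "cis t = 1"
    then have "cos t = 1"
      by (metis cis.sel(1) one_complex.sel(1))
    then obtain m :: int where m: "t = of_int m * 2 * pi"
      using cos_one_2pi_int by auto
    have "0 < t" "t < 1 * (2 * pi)"
      using t by auto
    then have "0 < real_of_int m * (2 * pi)" "real_of_int m * (2 * pi) < 1 * (2 * pi)"
      unfolding m mult.assoc by simp_all
    then have "0 < m" "m < 1"
      by (simp_all only: zero_less_mult_iff mult_less_cancel_right) auto
    then show False
      by simp
  qed
  then have "AE t in uniform_measure lborel {0..<2 * pi}. cis t \<noteq> 1"
    using AE_lborel_singleton[of "0::real"]
    by (intro AE_uniform_measureI) (auto elim!: eventually_mono)
  moreover have "{z \<in> space (restrict_space borel (sphere 0 1)). z \<noteq> (1 :: complex)} \<in> sets (restrict_space borel (sphere 0 1))"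
  proof -
    have "{z \<in> space (restrict_space borel (sphere 0 1)). z \<noteq> (1 :: complex)} = sphere 0 1 \<inter> (- {1})"
      by (auto simp: space_restrict_space)
    then show ?thesis
      by (auto simp: sets_restrict_space)
  qed
  ultimately show ?thesis
    unfolding haar_circle_def by (simp add: AE_distr_iff[OF measurable_cis_circle])
qed

context factor_product
begin

text \<open>On the torus a factor vanishes only where \<open>w n ^ k n = 1\<close>, a null set by
  invariance under powers.\<close>

lemma AE_factors_nonzero: "AE w in haar_polytorus. \<forall>n. factors n (w n) \<noteq> 0"
proof -
  have m: "(\<lambda>z. z ^ k n) \<in> haar_circle \<rightarrow>\<^sub>M haar_circle" for n
    using measurable_power_circle[of "k n"] by (simp add: haar_circle_def cong: measurable_cong_sets)
  have "AE z in haar_circle. z ^ k n \<noteq> 1" for n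
    by (rule AE_distrD[OF m[of n], of "\<lambda>z. z \<noteq> 1"])
       (subst distr_haar_circle_power[OF k_pos], rule AE_haar_circle_neq_1)
  then have "AE w in haar_polytorus. w n ^ k n \<noteq> 1" for n
    unfolding haar_polytorus_def
    by (intro AE_PiM_component[of UNIV "\<lambda>_. haar_circle" n "\<lambda>z. z ^ k n \<noteq> 1"] prob_space_haar_circle) auto
  then have "AE w in haar_polytorus. \<forall>n. w n ^ k n \<noteq> 1"
    by (simp add: AE_all_countable)
  then show ?thesis
    using AE_polytorus_norm
    by eventually_elim (simp add: factors_def factor_eq_0_iff[OF e_pos e_le_1] norm_power)
qed

end

locale factor_blocks = factor_product +
  fixes N :: "nat \<Rightarrow> nat"
  assumes strict_mono_N: "strict_mono N" and N_0: "N 0 = 0"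
    and sum_block: "(\<Sum>n=N b..<N (Suc b). e n) \<le> (1 / 4) ^ b"
begin

definition block_prod :: "nat \<Rightarrow> (nat \<Rightarrow> complex) \<Rightarrow> complex" where
  "block_prod b w = (\<Prod>n=N b..<N (Suc b). factors n (w n))"

text \<open>The limit is along block ends, the partial products whose convergence is shown. On the
  null set where it fails, \<open>lim\<close> gives some unspecified value.\<close>

definition boundary :: "(nat \<Rightarrow> complex) \<Rightarrow> complex" where
  "boundary w = lim (\<lambda>B. \<Prod>n<N B. factors n (w n))"

lemma prod_N_eq: "(\<Prod>n<N B. f n) = (\<Prod>b<B. \<Prod>n=N b..<N (Suc b). f n)"
proof (induction B)
  case (Suc B)
  have "N B \<le> N (Suc B)"
    using strict_mono_N by (simp add: strict_mono_less_eq)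
  then have "{..<N (Suc B)} = {..<N B} \<union> {N B..<N (Suc B)}"
    by auto
  then have "(\<Prod>n<N (Suc B). f n) = (\<Prod>n<N B. f n) * (\<Prod>n=N B..<N (Suc B). f n)"
    by (simp add: prod.union_disjoint ivl_disj_int)
  then show ?case
    using Suc by simp
qed (simp add: N_0)

text \<open>The second moment is of order 4^-b; its square root 2^-b governs the first moment and is
  still summable.\<close>

lemma integral_norm_block_prod_minus_1:
  shows "integrable haar_polytorus (\<lambda>w. cmod (block_prod b w - 1))"
    and "(LINT w|haar_polytorus. cmod (block_prod b w - 1)) \<le> 3 / 2 * (1 / 2) ^ b"
proof -
  interpret prob_space haar_polytorus
    by (rule prob_space_haar_polytorus)
  show int: "integrable haar_polytorus (\<lambda>w. cmod (block_prod b w - 1))"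
    unfolding block_prod_def using integrable_prod_factors by simp
  let ?y = "(1 / 4 :: real) ^ b"
  have y: "0 \<le> ?y" "?y \<le> 1"
    by (auto simp: power_le_one)
  have int2: "integrable haar_polytorus (\<lambda>w. (cmod (block_prod b w - 1))\<^sup>2)"
    unfolding block_prod_def by (rule integral_prod_factors_minus_1) simp
  have "(LINT w|haar_polytorus. (cmod (block_prod b w - 1))\<^sup>2) \<le> exp (\<Sum>n=N b..<N (Suc b). e n) - 1"
    unfolding block_prod_def by (rule integral_prod_factors_minus_1) simp
  also have "\<dots> \<le> exp ?y - 1"
    using sum_block by simp
  also have "\<dots> \<le> ?y + ?y\<^sup>2"
    using exp_bound[OF y] by simp
  also have "\<dots> \<le> 2 * ?y"
    using mult_left_le[OF y(2) y(1)] unfolding power2_eq_square by linarith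
  finally have sq: "(LINT w|haar_polytorus. (cmod (block_prod b w - 1))\<^sup>2) \<le> 2 * ?y" .
  \<comment> \<open>Weighted arithmetic-geometric mean inequality; the weight \<open>2 ^ b\<close>
    brings a squared deviation of size 4^-b to the size 2^-b of the other term.\<close>
  have amgm: "x \<le> ((1 / 2) ^ b + 2 ^ b * x\<^sup>2) / 2" for x :: real
  proof -
    have "0 \<le> (1 / 2) ^ b * (2 ^ b * x - 1)\<^sup>2"
      by simp
    also have "\<dots> = ((1 / 2) ^ b * 2 ^ b) * (2 ^ b * x\<^sup>2) - 2 * ((1 / 2) ^ b * 2 ^ b) * x + (1 / 2) ^ b"
      by (simp only: power2_eq_square) (simp add: algebra_simps)
    also have "(1 / 2) ^ b * 2 ^ b = (1::real)"
      by (simp flip: power_mult_distrib)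
    finally show ?thesis
      by simp
  qed
  have "(LINT w|haar_polytorus. cmod (block_prod b w - 1))
      \<le> (LINT w|haar_polytorus. ((1 / 2) ^ b + 2 ^ b * (cmod (block_prod b w - 1))\<^sup>2) / 2)"
    using int int2 by (intro integral_mono amgm) auto
  also have "\<dots> = ((1 / 2) ^ b + 2 ^ b * (LINT w|haar_polytorus. (cmod (block_prod b w - 1))\<^sup>2)) / 2"
    using int2 by (simp add: prob_space)
  also have "\<dots> \<le> ((1 / 2) ^ b + 2 ^ b * (2 * ?y)) / 2"
    using sq by (intro divide_right_mono add_left_mono mult_left_mono) auto
  also have "2 ^ b * (2 * ?y) = 2 * (1 / 2) ^ b"
    by (simp add: power_mult_distrib[symmetric] mult.left_commute)
  finally show "(LINT w|haar_polytorus. cmod (block_prod b w - 1)) \<le> 3 / 2 * (1 / 2) ^ b"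
    by simp
qed

lemma AE_boundary:
  "AE w in haar_polytorus. (\<lambda>B. \<Prod>n<N B. factors n (w n)) \<longlonglongrightarrow> boundary w \<and> boundary w \<noteq> 0"
proof -
  have "AE w in haar_polytorus. summable (\<lambda>b. cmod (block_prod b w - 1))"
    by (rule AE_summable_of_integrals[OF integral_norm_block_prod_minus_1(1) norm_ge_zero
          integral_norm_block_prod_minus_1(2)])
       (intro summable_mult summable_geometric, simp)
  then show ?thesis
    using AE_factors_nonzero
  proof eventually_elim
    case (elim w)
    have conv: "convergent_prod (\<lambda>b. block_prod b w)"
      by (rule abs_convergent_prod_imp_convergent_prod[OF summable_imp_abs_convergent_prod[OF elim(1)]])
    \<comment> \<open>\<open>convergent_prod_LIMSEQ\<close> speaks of products over b \<le> B, hence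
      the shift to \<open>Suc B\<close>, undone by \<open>LIMSEQ_imp_Suc\<close>.\<close>
    have "(\<lambda>B. \<Prod>n<N (Suc B). factors n (w n)) \<longlonglongrightarrow> prodinf (\<lambda>b. block_prod b w)"
      using convergent_prod_LIMSEQ[OF conv]
      by (simp only: prod_N_eq lessThan_Suc_atMost) (simp add: block_prod_def)
    then have lim: "(\<lambda>B. \<Prod>n<N B. factors n (w n)) \<longlonglongrightarrow> prodinf (\<lambda>b. block_prod b w)"
      by (rule LIMSEQ_imp_Suc)
    then have "boundary w = prodinf (\<lambda>b. block_prod b w)"
      unfolding boundary_def by (rule limI)
    moreover have "prodinf (\<lambda>b. block_prod b w) \<noteq> 0"
      using elim(2) by (intro prodinf_nonzero conv) (simp add: block_prod_def)
    ultimately show ?case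
      using lim by simp
  qed
qed

section \<open>The boundary function as an element of the Hardy space\<close>

lemma borel_measurable_boundary: "boundary \<in> borel_measurable haar_polytorus"
  unfolding boundary_def by (intro borel_measurable_lim_metric borel_measurable_prod_factors)

lemma norm_partial_product_le:
  assumes "\<And>n. cmod (w n) \<le> 1"
  shows "cmod (\<Prod>n<M. factors n (w n)) \<le> exp (\<Sum>n. e n)"
proof -
  have "cmod (\<Prod>n<M. factors n (w n)) \<le> exp (\<Sum>n<M. e n)"
    using assms by (intro norm_prod_factors_le)
  also have "\<dots> \<le> exp (\<Sum>n. e n)"
    using e_pos summable_e by (simp add: sum_le_suminf less_imp_le)
  finally show ?thesis .
qed

lemma AE_norm_boundary_le: "AE w in haar_polytorus. cmod (boundary w) \<le> exp (\<Sum>n. e n)"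
  using AE_boundary AE_polytorus_norm
proof eventually_elim
  case (elim w)
  then have "(\<lambda>B. cmod (\<Prod>n<N B. factors n (w n))) \<longlonglongrightarrow> cmod (boundary w)"
    by (intro tendsto_norm) simp
  then show ?case
    by (rule LIMSEQ_le_const2) (use elim in \<open>auto intro!: norm_partial_product_le\<close>)
qed

text \<open>Dominated convergence passes to the partial products, whose coefficients are constant
  once \<open>N B\<close> exceeds the support of \<gamma>: every further factor has constant
  coefficient 1.\<close>

lemma fourier_coeff_boundary:
  assumes fin: "finite {n. \<gamma> n \<noteq> 0}"
  shows "fourier_coeff boundary \<gamma>
    = (\<Prod>n | \<gamma> n \<noteq> 0. if 0 \<le> \<gamma> n then factor_coeff (e n) (k n) (nat (\<gamma> n)) else 0)"
    (is "_ = ?c")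
proof -
  interpret prob_space haar_polytorus
    by (rule prob_space_haar_polytorus)
  let ?\<chi> = "\<lambda>w. \<Prod>n | \<gamma> n \<noteq> 0. w n powi \<gamma> n"
  let ?P = "\<lambda>B w. \<Prod>n<N B. factors n (w n)"
  have "(\<lambda>z. z powi m :: complex) \<in> borel_measurable borel" for m
    unfolding power_int_def by measurable
  then have "?\<chi> \<in> borel_measurable haar_polytorus"
    by (intro borel_measurable_prod borel_measurable_polytorus_coordinate)
  then have \<chi>: "(\<lambda>w. cnj (?\<chi> w)) \<in> borel_measurable haar_polytorus"
    by (rule measurable_compose) (intro borel_measurable_continuous_onI continuous_intros)
  have "(\<lambda>B. fourier_coeff (?P B) \<gamma>) \<longlonglongrightarrow> fourier_coeff boundary \<gamma>"
    unfolding fourier_coeff_def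
  proof (rule integral_dominated_convergence[where w = "\<lambda>_. exp (\<Sum>n. e n)"])
    show "(\<lambda>w. boundary w * cnj (?\<chi> w)) \<in> borel_measurable haar_polytorus"
      by (intro borel_measurable_times borel_measurable_boundary \<chi>)
    show "(\<lambda>w. ?P B w * cnj (?\<chi> w)) \<in> borel_measurable haar_polytorus" for B
      by (intro borel_measurable_times borel_measurable_prod_factors \<chi>)
    show "AE w in haar_polytorus. (\<lambda>B. ?P B w * cnj (?\<chi> w)) \<longlonglongrightarrow> boundary w * cnj (?\<chi> w)"
      using AE_boundary by eventually_elim (intro tendsto_intros, simp)
    show "AE w in haar_polytorus. cmod (?P B w * cnj (?\<chi> w)) \<le> exp (\<Sum>n. e n)" for B
      using AE_polytorus_norm
    proof eventually_elim
      case (elim w)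
      then have "cmod (cnj (?\<chi> w)) = 1"
        by (simp add: norm_power_int flip: prod_norm)
      then show ?case
        using norm_partial_product_le[of w "N B"] elim by (simp add: norm_mult)
    qed
  qed simp
  moreover have "\<forall>\<^sub>F B in sequentially. fourier_coeff (?P B) \<gamma> = ?c"
  proof -
    obtain M where M: "{n. \<gamma> n \<noteq> 0} \<subseteq> {..<M}"
      using finite_nat_bounded[OF fin] by blast
    show ?thesis
    proof (rule eventually_sequentiallyI)
      fix B assume "M \<le> B"
      then have sub: "{n. \<gamma> n \<noteq> 0} \<subseteq> {..<N B}"
        using M strict_mono_imp_increasing[OF strict_mono_N, of B] by fastforce
      have "fourier_coeff (?P B) \<gamma>
          = (\<Prod>n<N B. if 0 \<le> \<gamma> n then factor_coeff (e n) (k n) (nat (\<gamma> n)) else 0)"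
        by (rule fourier_coeff_prod[OF borel_measurable_factors summable_factor_coeff[OF e_pos e_le_1 k_pos] _ sub])
           (unfold factors_def, rule sums_factor_coeff[OF e_pos e_le_1 k_pos])
      also have "\<dots> = ?c"
        using sub by (intro prod.mono_neutral_right) auto
      finally show "fourier_coeff (?P B) \<gamma> = ?c" .
    qed
  qed
  then have "(\<lambda>B. fourier_coeff (?P B) \<gamma>) \<longlonglongrightarrow> ?c"
    by (rule tendsto_eventually)
  ultimately show ?thesis
    by (rule LIMSEQ_unique)
qed

lemma boundary_in_Hinf: "boundary \<in> Hinf_polytorus"
  unfolding Hinf_polytorus_def
proof (intro CollectI conjI allI impI)
  show "\<exists>C. AE w in haar_polytorus. cmod (boundary w) \<le> C"
    using AE_norm_boundary_le by blast
  fix \<gamma> :: "nat \<Rightarrow> int"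
  assume \<gamma>: "finite {n. \<gamma> n \<noteq> 0} \<and> \<not> (\<forall>n. 0 \<le> \<gamma> n)"
  then obtain m where "\<gamma> m < 0"
    by (auto simp: not_le)
  then have "(\<Prod>n | \<gamma> n \<noteq> 0. if 0 \<le> \<gamma> n then factor_coeff (e n) (k n) (nat (\<gamma> n)) else 0) = 0"
    using \<gamma> by (intro prod_zero bexI[of _ m]) auto
  then show "fourier_coeff boundary \<gamma> = 0"
    using \<gamma> by (simp add: fourier_coeff_boundary)
qed (rule borel_measurable_boundary)

lemma is_holomorphic_extension_boundary: "is_holomorphic_extension boundary extension"
  unfolding is_holomorphic_extension_def has_monomial_coeffs_def
proof (intro conjI ballI impI holomorphic_extension)
  show "\<exists>C. \<forall>z\<in>c0_ball. cmod (extension z) \<le> C"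
    using norm_extension_le by blast
  fix z assume z: "z \<in> c0_ball" "finite {n. z n \<noteq> 0}"
  then obtain M where M: "{n. z n \<noteq> 0} \<subseteq> {..<M}"
    using finite_nat_bounded by blast
  have z1: "cmod (z n) < 1" for n
    using z(1) by (simp add: c0_ball_def)
  have z0: "z n = 0" if "M \<le> n" for n
    using M that by (metis (mono_tags, lifting) lessThan_iff mem_Collect_eq not_less subsetD)
  have "((\<lambda>\<alpha>. (\<Prod>n | \<alpha> n \<noteq> 0. factor_coeff (e n) (k n) (\<alpha> n)) * (\<Prod>n | \<alpha> n \<noteq> 0. z n ^ \<alpha> n))
      has_sum (\<Prod>n<M. factors n (z n))) {\<alpha>. finite {n. \<alpha> n \<noteq> 0}}"
    by (rule has_sum_monomials[OF summable_factor_coeff[OF e_pos e_le_1 k_pos] factor_coeff_0])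
       (unfold factors_def, auto intro: sums_factor_coeff[OF e_pos e_le_1 k_pos] less_imp_le z1 z0)
  also have "(\<Prod>n<M. factors n (z n)) = extension z"
    by (rule extension_finite_support[symmetric, OF z1 z0])
  finally show "((\<lambda>\<alpha>. fourier_coeff boundary (\<lambda>n. int (\<alpha> n)) * (\<Prod>n | \<alpha> n \<noteq> 0. z n ^ \<alpha> n))
      has_sum extension z) {\<alpha>. finite {n. \<alpha> n \<noteq> 0}}"
    by (rule has_sum_cong[THEN iffD1, rotated]) (simp add: fourier_coeff_boundary)
qed

end

section \<open>Small values of a factor along dyadic radii\<close>

lemma cos_ge_one_minus_half_square: "1 - t\<^sup>2 / 2 \<le> cos (t::real)"
proof -
  have "(sin (t / 2))\<^sup>2 \<le> (t / 2)\<^sup>2"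
    using abs_sin_x_le_abs_x[of "t / 2"] by (simp only: abs_le_square_iff)
  moreover have "cos t = 1 - 2 * (sin (t / 2))\<^sup>2"
    using cos_double_sin[of "t / 2"] by simp
  ultimately show ?thesis
    by (simp add: power_divide)
qed

text \<open>With u = z / (1 - z) the factor is 1 / (1 + e u). Here |1 - z| is at most a multiple of
  \<delta> and Re u \<ge> 3 / (16 \<delta>), so the denominator has modulus at least 1 + x with x =
  3 e / (16 \<delta>). As e \<le> \<delta> keeps x \<le> 1, the value is at most 1 - x / 2.\<close>

lemma norm_factor_le_near_1:
  assumes e: "0 < e" "e \<le> \<delta>" and \<delta>: "\<delta> \<le> 1 / 2" and t: "0 \<le> t" "t \<le> \<delta>"
  shows "cmod (factor e (of_real (1 - \<delta>) * cis t)) \<le> 1 - 3 / 32 * (e / \<delta>)"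
proof -
  define r where "r = 1 - \<delta>"
  define z where "z = of_real r * cis t"
  define u where "u = z / (1 - z)"
  have \<delta>0: "0 < \<delta>"
    using e by linarith
  have r: "1 / 2 \<le> r" "r < 1"
    using \<delta> \<delta>0 by (auto simp: r_def)
  have t2: "t\<^sup>2 \<le> \<delta>\<^sup>2"
    using t by (intro power_mono) auto
  have cos: "1 - \<delta>\<^sup>2 / 2 \<le> cos t"
    using cos_ge_one_minus_half_square[of t] t2 by linarith
  have "cmod z = r"
    using r by (simp add: z_def norm_mult)
  then have z1: "1 - z \<noteq> 0"
    using r by auto
  have norm: "(cmod (1 - z))\<^sup>2 = 1 - 2 * r * cos t + r\<^sup>2"
  proof -
    have "(cmod (1 - z))\<^sup>2 = (1 - r * cos t)\<^sup>2 + (r * sin t)\<^sup>2"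
      by (simp add: cmod_power2 z_def)
    also have "\<dots> = 1 - 2 * r * cos t + r\<^sup>2 * ((sin t)\<^sup>2 + (cos t)\<^sup>2)"
      by algebra
    finally show ?thesis
      by simp
  qed
  have "(cmod (1 - z))\<^sup>2 = \<delta>\<^sup>2 + 2 * r * (1 - cos t)"
    unfolding norm by (simp add: r_def power2_eq_square algebra_simps)
  also have "2 * r * (1 - cos t) \<le> 2 * 1 * (\<delta>\<^sup>2 / 2)"
    using r cos by (intro mult_mono) auto
  finally have up: "(cmod (1 - z))\<^sup>2 \<le> 2 * \<delta>\<^sup>2"
    by simp
  have pos: "0 < (cmod (1 - z))\<^sup>2"
    using z1 by simp
  have "Re u * (cmod (1 - z))\<^sup>2 = r * (cos t - r)"
  proof -
    have "u * of_real ((cmod (1 - z))\<^sup>2) = z * cnj (1 - z)"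
      using z1 unfolding complex_norm_square u_def by simp
    then have "Re (u * of_real ((cmod (1 - z))\<^sup>2)) = Re (z * cnj (1 - z))"
      by simp
    also have "\<dots> = r * cos t * (1 - r * cos t) - (r * sin t) * (r * sin t)"
      by (simp add: z_def)
    also have "\<dots> = r * cos t - r\<^sup>2 * ((sin t)\<^sup>2 + (cos t)\<^sup>2)"
      by algebra
    finally show ?thesis
      by (simp add: power2_eq_square algebra_simps)
  qed
  \<comment> \<open>cos t - r is at least \<delta> - \<delta>^2 / 2, hence at least 3/4 \<delta>
    since \<delta> \<le> 1/2; and r \<ge> 1/2.\<close>
  also have "r * (cos t - r) \<ge> 1 / 2 * (3 / 4 * \<delta>)"
  proof (rule mult_mono)
    have "\<delta> * \<delta> \<le> \<delta> * (1 / 2)"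
      using \<delta> \<delta>0 by (intro mult_left_mono) auto
    then show "3 / 4 * \<delta> \<le> cos t - r"
      using cos by (simp add: r_def power2_eq_square)
  qed (use r \<delta>0 in auto)
  finally have low: "3 / 8 * \<delta> \<le> Re u * (cmod (1 - z))\<^sup>2"
    by simp
  have u0: "0 < Re u"
  proof -
    have "0 < Re u * (cmod (1 - z))\<^sup>2"
      using low \<delta>0 by linarith
    then show ?thesis
      using pos by (simp only: zero_less_mult_iff) auto
  qed
  have "Re u * (cmod (1 - z))\<^sup>2 \<le> Re u * (2 * \<delta>\<^sup>2)"
    using up u0 by (intro mult_left_mono) auto
  with low have "3 / 8 * \<delta> \<le> (Re u * 2 * \<delta>) * \<delta>"
    by (simp add: power2_eq_square mult_ac)
  then have "3 / 8 \<le> Re u * 2 * \<delta>"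
    using \<delta>0 by simp
  then have "3 / (16 * \<delta>) \<le> Re u"
    using \<delta>0 by (simp add: field_simps)
  then have "e * (3 / (16 * \<delta>)) \<le> e * Re u"
    using e by (intro mult_left_mono) auto
  define x where "x = 3 / 16 * (e / \<delta>)"
  have "e / \<delta> \<le> 1" "0 \<le> e / \<delta>"
    using e \<delta>0 by auto
  then have x: "0 \<le> x" "x \<le> 1"
    by (auto simp: x_def)
  have "factor e z = 1 / (1 + of_real e * u)"
    using z1 by (simp add: factor_def u_def field_simps)
  then have "cmod (factor e z) = 1 / cmod (1 + of_real e * u)"
    by (simp add: norm_divide)
  also have "\<dots> \<le> 1 / (1 + x)"
  proof (rule divide_left_mono)
    have "1 + x \<le> Re (1 + of_real e * u)"
      using \<open>e * (3 / (16 * \<delta>)) \<le> e * Re u\<close> by (simp add: x_def)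
    then show "1 + x \<le> cmod (1 + of_real e * u)"
      using complex_Re_le_cmod order_trans by blast
    then show "0 < cmod (1 + of_real e * u) * (1 + x)"
      using x by (intro mult_pos_pos) auto
  qed simp
  also have "\<dots> \<le> 1 - x / 2"
  proof -
    have "x * x \<le> x * 1"
      using x by (intro mult_left_mono) auto
    then show ?thesis
      using x by (simp add: field_simps)
  qed
  finally show ?thesis
    by (simp add: x_def z_def r_def)
qed

definition min_factor :: "real \<Rightarrow> nat \<Rightarrow> complex \<Rightarrow> real" where
  "min_factor e L z = Min ((\<lambda>l. cmod (factor e (of_real (1 - (1 / 2) ^ l) * z))) ` {1..L})"

lemma min_factor_le:
  "l \<in> {1..L} \<Longrightarrow> min_factor e L z \<le> cmod (factor e (of_real (1 - (1 / 2) ^ l) * z))"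
  unfolding min_factor_def by (intro Min_le) auto

lemma min_factor_attained:
  assumes "1 \<le> L"
  shows "\<exists>l\<in>{1..L}. cmod (factor e (of_real (1 - (1 / 2) ^ l) * z)) = min_factor e L z"
proof -
  have "min_factor e L z \<in> (\<lambda>l. cmod (factor e (of_real (1 - (1 / 2) ^ l) * z))) ` {1..L}"
    unfolding min_factor_def using assms by (intro Min_in) auto
  then show ?thesis
    by force
qed

lemma min_factor_nonneg: "1 \<le> L \<Longrightarrow> 0 \<le> min_factor e L z"
  using min_factor_attained[of L e z] by (metis norm_ge_zero)

lemma borel_measurable_min_factor [measurable]: "min_factor e L \<in> borel_measurable borel"
  unfolding min_factor_def
  by (intro borel_measurable_Min measurable_compose[OF _ borel_measurable_norm]
        measurable_compose[OF _ borel_measurable_factor]) auto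

lemma min_factor_le_1_plus:
  assumes "0 < e" "e \<le> 1" "1 \<le> L" "cmod z = 1"
  shows "min_factor e L z \<le> 1 + e"
proof -
  have "min_factor e L z \<le> cmod (factor e (of_real (1 - (1 / 2) ^ 1) * z))"
    using assms by (intro min_factor_le) auto
  also have "\<dots> \<le> 1 + e"
    using assms by (intro norm_factor_le) (auto simp: norm_mult)
  finally show ?thesis .
qed

text \<open>One side of 1 suffices, at the cost of a constant factor; half-open intervals make the
  scales disjoint.\<close>

definition dyadic_angles :: "nat \<Rightarrow> real set" where
  "dyadic_angles l = {(1 / 2) ^ Suc l<..(1 / 2) ^ l}"

lemma dyadic_angles_disjoint:
  assumes "t \<in> dyadic_angles l" "t \<in> dyadic_angles l'"
  shows "l = l'"
proof -
  have "\<not> a < b" if "t \<in> dyadic_angles a" "t \<in> dyadic_angles b" for a b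
  proof
    assume "a < b"
    then have "(1 / 2 :: real) ^ b \<le> (1 / 2) ^ Suc a"
      by (intro power_decreasing) auto
    moreover have "(1 / 2) ^ Suc a < t" "t \<le> (1 / 2) ^ b"
      using that by (simp_all only: dyadic_angles_def greaterThanAtMost_iff)
    ultimately show False
      by (meson not_le order_trans)
  qed
  from this[OF assms] this[OF assms(2,1)] show ?thesis
    by simp
qed

text \<open>At most one term of the sum is nonzero. On scale \<open>l\<close> the radius 1 - 2^-l
  gains 3/32 e 2^l, the bound e \<le> 2^-L covering all these scales; at other angles the trivial
  bound 1 + e remains.\<close>

lemma min_factor_cis_le:
  assumes e: "0 < e" "e \<le> (1 / 2) ^ L" and L: "1 \<le> L"
  shows "min_factor e L (cis t)
    \<le> 1 + e - 3 / 32 * e * (\<Sum>l=1..L. 2 ^ l * indicator (dyadic_angles l) t)"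
proof -
  have e1: "e \<le> 1"
    using e(2) power_le_one[of "1 / 2 :: real" L] by simp
  show ?thesis
  proof (cases "\<exists>l\<in>{1..L}. t \<in> dyadic_angles l")
    case True
    then obtain l where l: "l \<in> {1..L}" "t \<in> dyadic_angles l"
      by blast
    have "(\<Sum>l'=1..L. 2 ^ l' * indicator (dyadic_angles l') t) = (\<Sum>l'=1..L. if l' = l then 2 ^ l else 0 :: real)"
    proof (intro sum.cong refl)
      fix l'
      show "2 ^ l' * indicator (dyadic_angles l') t = (if l' = l then 2 ^ l else 0 :: real)"
        using l(2) dyadic_angles_disjoint[OF l(2), of l'] by (cases "l' = l") (simp_all add: indicator_def, blast)
    qed
    then have sum: "(\<Sum>l'=1..L. 2 ^ l' * indicator (dyadic_angles l') t) = (2 ^ l :: real)"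
      using l(1) by simp
    have p: "(1 / 2 :: real) ^ L \<le> (1 / 2) ^ l" "(1 / 2 :: real) ^ l \<le> (1 / 2) ^ 1"
      using l(1) by (intro power_decreasing; simp)+
    have "0 \<le> t" "t \<le> (1 / 2) ^ l"
      using l(2) less_trans[of 0 "(1 / 2 :: real) ^ Suc l" t] by (auto simp: dyadic_angles_def)
    then have "cmod (factor e (of_real (1 - (1 / 2) ^ l) * cis t)) \<le> 1 - 3 / 32 * (e / (1 / 2) ^ l)"
      using p(2) by (intro norm_factor_le_near_1 e(1) order_trans[OF e(2) p(1)]) simp_all
    also have "e / (1 / 2) ^ l = e * 2 ^ l"
      by (simp add: power_divide)
    finally have "min_factor e L (cis t) \<le> 1 - 3 / 32 * (e * 2 ^ l)"
      using min_factor_le[OF l(1), of e "cis t"] by linarith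
    then show ?thesis
      using e unfolding sum by simp
  next
    case False
    then have "(\<Sum>l=1..L. 2 ^ l * indicator (dyadic_angles l) t) = (0 :: real)"
      by (intro sum.neutral) auto
    then show ?thesis
      using min_factor_le_1_plus[OF e(1) e1 L, of "cis t"] by simp
  qed
qed

lemma measure_dyadic_angles:
  "measure (uniform_measure lborel {0..<2 * pi}) (dyadic_angles l) = (1 / 2) ^ Suc l / (2 * pi)"
proof -
  have "(1 / 2 :: real) ^ l \<le> 1"
    by (simp add: power_le_one)
  moreover have "1 < 2 * pi"
    using pi_gt3 by simp
  moreover have "0 < (1 / 2 :: real) ^ Suc l"
    by simp
  ultimately have "{0..<2 * pi} \<inter> dyadic_angles l = {(1 / 2) ^ Suc l<..(1 / 2) ^ l}"
    unfolding dyadic_angles_def by fastforce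
  moreover have "measure lborel {(1 / 2 :: real) ^ Suc l<..(1 / 2) ^ l} = (1 / 2) ^ Suc l"
    by (simp add: measure_lborel_Ioc)
  ultimately show ?thesis
    by (subst measure_uniform_measure) (auto simp: dyadic_angles_def)
qed

text \<open>Gain 2^l times arc measure 2^-(l+1) / (2 pi) is 1 / (4 pi) at every scale, at least
  1/16; and 3/32 times 1/16 is 3/512.\<close>

lemma integral_min_factor_le:
  assumes e: "0 < e" "e \<le> (1 / 2) ^ L" and L: "1 \<le> L"
  shows "(LINT z|haar_circle. min_factor e L z) \<le> 1 + e * (1 - 3 / 512 * real L)"
proof -
  let ?U = "uniform_measure lborel {0..<2 * pi}"
  interpret U: prob_space ?U
    by (rule prob_space_uniform_angle)
  have e1: "e \<le> 1"
    using e(2) power_le_one[of "1 / 2 :: real" L] by simp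
  have ind: "integrable ?U (indicator (dyadic_angles l) :: real \<Rightarrow> real)" for l
    by (intro integrable_real_indicator)
       (simp add: dyadic_angles_def, simp only: U.emeasure_eq_measure infinity_ennreal_def ennreal_less_top)
  let ?S = "\<lambda>t. \<Sum>l=1..L. 2 ^ l * indicator (dyadic_angles l) t :: real"
  have sumS: "integrable ?U ?S"
    by (intro Bochner_Integration.integrable_sum integrable_mult_right ind)
  have intS: "integrable ?U (\<lambda>t. 1 + e - 3 / 32 * e * ?S t)"
    by (intro Bochner_Integration.integrable_diff U.integrable_const integrable_mult_right sumS)
  have cm: "(\<lambda>t. min_factor e L (cis t)) \<in> borel_measurable ?U"
  proof -
    have "cis \<in> borel_measurable borel"
      by (intro borel_measurable_continuous_onI continuous_intros)
    then show ?thesis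
      using measurable_compose[OF _ borel_measurable_min_factor] by (simp cong: measurable_cong_sets)
  qed
  have intm: "integrable ?U (\<lambda>t. min_factor e L (cis t))"
    using min_factor_nonneg[OF L] min_factor_le_1_plus[OF e(1) e1 L]
    by (intro U.integrable_const_bound[OF _ cm, of "1 + e"]) auto
  have "(LINT z|haar_circle. min_factor e L z) = (LINT t|?U. min_factor e L (cis t))"
    by (intro integral_haar_circle borel_measurable_min_factor)
  also have "\<dots> \<le> (LINT t|?U. 1 + e - 3 / 32 * e * (\<Sum>l=1..L. 2 ^ l * indicator (dyadic_angles l) t))"
    by (rule integral_mono[OF intm intS min_factor_cis_le[OF e L]])
  also have "\<dots> = 1 + e - 3 / 32 * e * (\<Sum>l=1..L. 2 ^ l * measure ?U (dyadic_angles l))"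
  proof -
    have "(LINT t|?U. 1 + e - 3 / 32 * e * ?S t) = (LINT t|?U. 1 + e) - 3 / 32 * e * (LINT t|?U. ?S t)"
      by (subst Bochner_Integration.integral_diff)
         (intro U.integrable_const integrable_mult_right sumS, intro U.integrable_const integrable_mult_right sumS, simp only: integral_mult_right_zero)
    also have "(LINT t|?U. 1 + e) = 1 + e"
      by (simp only: lebesgue_integral_const U.prob_space scaleR_one)
    also have "(LINT t|?U. ?S t) = (\<Sum>l=1..L. LINT t|?U. 2 ^ l * indicator (dyadic_angles l) t)"
      by (intro Bochner_Integration.integral_sum integrable_mult_right ind)
    also have "\<dots> = (\<Sum>l=1..L. 2 ^ l * measure ?U (dyadic_angles l))"
      by (intro sum.cong refl) simp
    finally show ?thesis .
  qed
  also have "(\<Sum>l=1..L. 2 ^ l * measure ?U (dyadic_angles l)) = (\<Sum>l=1..L. 1 / (4 * pi))"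
    unfolding measure_dyadic_angles by (intro sum.cong) (auto simp: power_divide)
  also have "1 + e - 3 / 32 * e * \<dots> \<le> 1 + e - 3 / 32 * e * (real L / 16)"
  proof -
    have "1 / 16 \<le> 1 / (4 * pi)"
      using pi_less_4 by (simp add: field_simps)
    then have "real L * (1 / 16) \<le> real L * (1 / (4 * pi))"
      by (rule mult_left_mono) simp
    then have "3 / 32 * e * (real L / 16) \<le> 3 / 32 * e * (\<Sum>l=1..L. 1 / (4 * pi))"
      using e by (intro mult_left_mono) auto
    then show ?thesis
      by simp
  qed
  finally show ?thesis
    by (simp add: algebra_simps)
qed

section \<open>Blocks and radii\<close>

text \<open>Base 8 beats the block sums 4^-b, and the offset 3 cancels the denominator 512 of
  \<open>integral_min_factor_le\<close>.\<close>

definition level :: "nat \<Rightarrow> nat" where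
  "level b = 8 ^ (b + 3)"

text \<open>The subtraction never truncates, by \<open>level_ge\<close>, so block length times width
  is exactly 4^-b.\<close>

definition block_start :: "nat \<Rightarrow> nat" where
  "block_start b = (\<Sum>i<b. 2 ^ (level i - 2 * i))"

definition block_of :: "nat \<Rightarrow> nat" where
  "block_of n = (LEAST b. n < block_start (Suc b))"

definition width :: "nat \<Rightarrow> real" where
  "width n = (1 / 2) ^ level (block_of n)"

text \<open>The rapid decay of the exponents within a block makes all radii \<open>root (exponent n) (1 - (1 / 2) ^ c n)\<close>
  with \<open>c n\<close> between \<open>1\<close> and the level decreasing in \<open>n\<close>, however the \<open>c n\<close> are chosen.\<close>

definition exponent :: "nat \<Rightarrow> nat" where
  "exponent n = 2 ^ (level (block_of n) * (block_start (Suc (block_of n)) - 1 - n))"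

lemma level_ge: "2 * b \<le> level b" "b \<le> level b" "1 \<le> level b"
proof -
  have "b < 8 ^ b"
    by (rule less_exp[THEN less_le_trans]) (simp add: power_mono)
  then have "2 * b \<le> 8 ^ b * 8 ^ 3"
    by simp
  then show "2 * b \<le> level b"
    by (simp only: level_def power_add)
  then show "b \<le> level b"
    by simp
  show "1 \<le> level b"
    by (simp add: level_def)
qed

lemma block_start_0 [simp]: "block_start 0 = 0"
  by (simp add: block_start_def)

lemma block_start_Suc: "block_start (Suc b) = block_start b + 2 ^ (level b - 2 * b)"
  by (simp add: block_start_def)

lemma strict_mono_block_start: "strict_mono block_start"
  by (simp add: strict_mono_Suc_iff block_start_Suc)

lemma block_of_eqI:
  assumes "block_start b \<le> n" "n < block_start (Suc b)"
  shows "block_of n = b"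
  unfolding block_of_def
proof (rule Least_equality)
  fix c assume "n < block_start (Suc c)"
  then have "block_start b < block_start (Suc c)"
    using assms(1) by simp
  then show "b \<le> c"
    using strict_mono_less[OF strict_mono_block_start] by simp
qed (rule assms(2))

lemma width_block:
  assumes "n \<in> {block_start b..<block_start (Suc b)}"
  shows "width n = (1 / 2) ^ level b"
  using block_of_eqI[of b n] assms by (simp add: width_def)

lemma sum_width_block: "(\<Sum>n=block_start b..<block_start (Suc b). width n) = (1 / 4) ^ b"
proof -
  have "(\<Sum>n=block_start b..<block_start (Suc b). width n)
      = (\<Sum>n=block_start b..<block_start (Suc b). (1 / 2) ^ level b)"
    by (intro sum.cong refl width_block)
  also have "\<dots> = 2 ^ (level b - 2 * b) * (1 / 2) ^ (level b - 2 * b + 2 * b)"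
    using level_ge(1)[of b] by (simp add: block_start_Suc)
  also have "\<dots> = (1 / 2) ^ (2 * b)"
    by (simp only: power_add mult.assoc[symmetric] power_mult_distrib[symmetric]) simp
  finally show ?thesis
    by (simp add: power_mult power_divide)
qed

lemma sum_width_le: "(\<Sum>n<M. width n) \<le> 2"
proof -
  have eq: "(\<Sum>n<block_start B. width n) = (\<Sum>b<B. (1 / 4) ^ b)" for B
  proof (induction B)
    case (Suc B)
    have "{..<block_start (Suc B)} = {..<block_start B} \<union> {block_start B..<block_start (Suc B)}"
      by (auto simp: block_start_Suc)
    then have "(\<Sum>n<block_start (Suc B). width n)
        = (\<Sum>n<block_start B. width n) + (\<Sum>n=block_start B..<block_start (Suc B). width n)"
      by (simp add: sum.union_disjoint ivl_disj_int)
    then show ?case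
      using Suc by (simp only: sum_width_block sum.lessThan_Suc)
  qed simp
  have "(\<Sum>n<M. width n) \<le> (\<Sum>n<block_start M. width n)"
    using strict_mono_imp_increasing[OF strict_mono_block_start, of M]
    by (intro sum_mono2) (auto simp: width_def)
  also have "\<dots> = (\<Sum>b<M. (1 / 4) ^ b)"
    by (rule eq)
  also have "\<dots> \<le> (\<Sum>b. (1 / 4) ^ b)"
    by (intro sum_le_suminf summable_geometric) auto
  also have "\<dots> \<le> 2"
    by (subst suminf_geometric) auto
  finally show ?thesis .
qed

interpretation blocks: factor_blocks width exponent block_start
proof
  show "width n \<le> 1" for n
    by (simp add: width_def power_le_one)
  show "summable width"
    by (rule summableI_nonneg_bounded[OF _ sum_width_le]) (simp add: width_def)
qed (simp_all only: sum_width_block strict_mono_block_start block_start_0, simp_all add: width_def exponent_def)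

text \<open>Extensional functions, so that each block has finitely many choices and all of them
  together can be enumerated.\<close>

definition choices :: "nat \<Rightarrow> (nat \<Rightarrow> nat) set" where
  "choices b = PiE {block_start b..<block_start (Suc b)} (\<lambda>_. {1..level b})"

text \<open>Before the block stands the largest value that its first coordinate can take, so the
  radii also decrease on entering it. The zeros behind it give membership in \<open>c0\<close> and
  finite support.\<close>

definition radius :: "nat \<Rightarrow> (nat \<Rightarrow> nat) \<Rightarrow> nat \<Rightarrow> real" where
  "radius b c n =
     (if n < block_start b then root (exponent (block_start b)) (1 - (1 / 2) ^ level b)
      else if n < block_start (Suc b) then root (exponent n) (1 - (1 / 2) ^ c n)
      else 0)"

lemma finite_choices: "finite (choices b)"
  unfolding choices_def by (intro finite_PiE) auto

lemma choices_nonempty: "choices b \<noteq> {}"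
  using level_ge(3)[of b] by (auto simp: choices_def PiE_eq_empty_iff)

lemma choices_bounds:
  assumes "c \<in> choices b" "block_start b \<le> n" "n < block_start (Suc b)"
  shows "1 \<le> c n" "c n \<le> level b"
  using assms by (auto simp: choices_def PiE_iff)

lemma one_minus_half_power: "0 \<le> 1 - (1 / 2 :: real) ^ l" "1 - (1 / 2 :: real) ^ l < 1"
  by (simp_all add: power_le_one)

lemma root_less_1: "0 < m \<Longrightarrow> x < 1 \<Longrightarrow> root m x < 1"
  using real_root_less_mono[of m x 1] by simp

lemma radius_bounds: "0 \<le> radius b c n" "radius b c n < 1"
  using one_minus_half_power blocks.k_pos by (auto simp: radius_def intro!: root_less_1)

text \<open>Bernoulli for 1 + x with x = 2^-L gives (1 + x)^(2^L) \<ge> 2, and (1 - x)(1 + x) \<le>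
  1. The power 2^L is the ratio of neighbouring exponents; it takes the largest dyadic radius below
  the smallest one, 1/2.\<close>

lemma one_minus_half_power_power_le: "(1 - (1 / 2 :: real) ^ L) ^ 2 ^ L \<le> 1 / 2"
proof -
  let ?x = "(1 / 2 :: real) ^ L"
  have x: "0 < ?x" "?x \<le> 1"
    by (auto simp: power_le_one)
  have "1 + real (2 ^ L) * ?x \<le> (1 + ?x) ^ 2 ^ L"
    using x by (intro Bernoulli_inequality) linarith
  moreover have "real (2 ^ L) * ?x = 1"
    by (simp add: power_mult_distrib[symmetric])
  ultimately have "2 \<le> (1 + ?x) ^ 2 ^ L"
    by simp
  then have "(1 - ?x) ^ 2 ^ L * 2 \<le> (1 - ?x) ^ 2 ^ L * (1 + ?x) ^ 2 ^ L"
    using x by (intro mult_left_mono) auto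
  also have "\<dots> = (1 - ?x\<^sup>2) ^ 2 ^ L"
    by (simp only: power_mult_distrib[symmetric]) (simp add: power2_eq_square algebra_simps)
  also have "\<dots> \<le> 1"
    using x by (intro power_le_one) (auto simp: power_le_one)
  finally show ?thesis
    by simp
qed

lemma decseq_radius:
  assumes c: "c \<in> choices b"
  shows "decseq (radius b c)"
  unfolding decseq_Suc_iff
proof
  fix n
  have mono_half: "1 - (1 / 2 :: real) ^ l \<le> 1 - (1 / 2) ^ l'" if "l \<le> l'" for l l'
    using power_decreasing[OF that, of "1 / 2 :: real"] by simp
  consider "Suc n < block_start b" | "Suc n = block_start b"
    | "block_start b \<le> n" "Suc n < block_start (Suc b)" | "block_start (Suc b) \<le> Suc n"
    by linarith
  then show "radius b c (Suc n) \<le> radius b c n"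
  proof cases
    case 1
    then show ?thesis
      by (simp add: radius_def)
  next
    case 2
    have lt: "block_start b < block_start (Suc b)"
      by (simp add: block_start_Suc)
    have "radius b c (Suc n) = root (exponent (block_start b)) (1 - (1 / 2) ^ c (block_start b))"
      using lt by (simp add: radius_def 2)
    moreover have "radius b c n = root (exponent (block_start b)) (1 - (1 / 2) ^ level b)"
      using 2 by (simp add: radius_def)
    ultimately show ?thesis
      using choices_bounds(2)[OF c order_refl lt] blocks.k_pos[of "block_start b"] mono_half
      by simp
  next
    case 3
    let ?L = "level b"
    have blk: "block_of n = b" "block_of (Suc n) = b"
      using 3 by (auto intro: block_of_eqI)
    have exponent: "exponent n = exponent (Suc n) * 2 ^ ?L"
    proof -
      have "block_start (Suc b) - 1 - n = Suc (block_start (Suc b) - 1 - Suc n)"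
        using 3 by simp
      then show ?thesis
        by (simp add: exponent_def blk power_add)
    qed
    \<comment> \<open>The worst case inside a block is \<open>c (Suc n) = level b\<close> against
      \<open>c n = 1\<close>.\<close>
    have "1 - (1 / 2) ^ c (Suc n) \<le> 1 - (1 / 2 :: real) ^ ?L"
      using choices_bounds(2)[OF c, of "Suc n"] 3 by (intro mono_half) simp
    also have "\<dots> = root (2 ^ ?L) ((1 - (1 / 2) ^ ?L) ^ 2 ^ ?L)"
      using one_minus_half_power by (simp add: real_root_power_cancel)
    also have "\<dots> \<le> root (2 ^ ?L) (1 - (1 / 2) ^ c n)"
    proof -
      have "(1 - (1 / 2 :: real) ^ ?L) ^ 2 ^ ?L \<le> 1 - (1 / 2) ^ 1"
        using one_minus_half_power_power_le[of ?L] by simp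
      also have "\<dots> \<le> 1 - (1 / 2) ^ c n"
        using choices_bounds(1)[OF c, of n] 3 by (intro mono_half) simp
      finally show ?thesis
        by (simp add: real_root_le_mono)
    qed
    finally have "root (exponent (Suc n)) (1 - (1 / 2) ^ c (Suc n))
        \<le> root (exponent (Suc n)) (root (2 ^ ?L) (1 - (1 / 2) ^ c n))"
      using blocks.k_pos by (simp add: real_root_le_mono)
    then show ?thesis
      using 3 by (simp add: radius_def exponent real_root_mult_exp)
  next
    case 4
    then show ?thesis
      using radius_bounds(1)[of b c n] by (simp add: radius_def block_start_Suc)
  qed
qed

lemma radius_tendsto_0: "radius b c \<longlonglongrightarrow> 0"
  by (rule tendsto_eventually, rule eventually_sequentiallyI[of "block_start (Suc b)"])
     (simp add: radius_def block_start_Suc)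

text \<open>Roots only increase numbers in [0, 1], and \<open>level b\<close> is at least
  \<open>b\<close>. For fixed n this covers all later blocks and gives convergence to 1.\<close>

lemma radius_ge:
  assumes "n < block_start b"
  shows "1 - (1 / 2) ^ b \<le> radius b c n"
proof -
  let ?x = "1 - (1 / 2 :: real) ^ level b" and ?k = "exponent (block_start b)"
  have "(1 / 2 :: real) ^ level b \<le> (1 / 2) ^ b"
    using level_ge(2) by (intro power_decreasing) auto
  then have "1 - (1 / 2) ^ b \<le> ?x"
    by simp
  also have "?x = root ?k (?x ^ ?k)"
    using one_minus_half_power blocks.k_pos by (simp add: real_root_power_cancel)
  also have "\<dots> \<le> root ?k (?x ^ 1)"
    using one_minus_half_power[of "level b"] blocks.k_pos[of "block_start b"]
    by (intro real_root_le_mono power_decreasing) auto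
  finally show ?thesis
    using assms by (simp add: radius_def)
qed

text \<open>The smallest modulus of the block product over all \<open>choices b\<close>: coordinates
  are chosen independently, so the minimum of the product is the product of the minima.\<close>

definition block_min :: "nat \<Rightarrow> (nat \<Rightarrow> complex) \<Rightarrow> real" where
  "block_min b w = (\<Prod>n=block_start b..<block_start (Suc b). min_factor (width n) (level b) (w n ^ exponent n))"

lemma block_min_nonneg: "0 \<le> block_min b w"
  unfolding block_min_def by (intro prod_nonneg min_factor_nonneg level_ge)

text \<open>Independence multiplies the bounds \<open>1 + width n * (1 - 3 * 8 ^ b)\<close>; in the
  exponential they sum to 4^-b - 3 2^b, which is at most -b.\<close>

lemma integral_block_min:
  shows "integrable haar_polytorus (block_min b)"
    and "(LINT w|haar_polytorus. block_min b w) \<le> (1 / 2) ^ b"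
proof -
  interpret prob_space haar_polytorus
    by (rule prob_space_haar_polytorus)
  let ?J = "{block_start b..<block_start (Suc b)}"
  have m: "(\<lambda>z. min_factor (width n) (level b) (z ^ exponent n)) \<in> borel_measurable borel" for n
    by (rule measurable_compose[OF _ borel_measurable_min_factor]) simp
  have bound: "norm (min_factor (width n) (level b) (z ^ exponent n)) \<le> 1 + width n" if "cmod z = 1" for n z
    using min_factor_le_1_plus[OF blocks.e_pos blocks.e_le_1 level_ge(3), of "z ^ exponent n" n b]
      min_factor_nonneg[OF level_ge(3), of "width n" b "z ^ exponent n"] that
    by (simp add: norm_power)
  have int: "integrable haar_circle (\<lambda>z. min_factor (width n) (level b) (z ^ exponent n))" for n
    by (rule integrable_haar_circle_bounded[OF m bound])
  show "integrable haar_polytorus (block_min b)"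
  proof (rule integrable_const_bound)
    show "block_min b \<in> borel_measurable haar_polytorus"
      unfolding block_min_def by (intro borel_measurable_prod borel_measurable_polytorus_coordinate[OF m])
    show "AE w in haar_polytorus. norm (block_min b w) \<le> (\<Prod>n\<in>?J. 1 + width n)"
      using blocks.AE_polytorus_norm
    proof eventually_elim
      case (elim w)
      then show ?case
        unfolding block_min_def prod_norm[symmetric] by (intro prod_mono conjI bound) auto
    qed
  qed
  have le: "(LINT z|haar_circle. min_factor (width n) (level b) (z ^ exponent n))
      \<le> exp ((1 / 2) ^ level b * (1 - 3 * 8 ^ b))" if "n \<in> ?J" for n
  proof -
    have "(LINT z|haar_circle. min_factor (width n) (level b) (z ^ exponent n))
        = (LINT z|haar_circle. min_factor (width n) (level b) z)"
      by (rule integral_haar_circle_power[OF blocks.k_pos borel_measurable_min_factor])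
    also have "\<dots> \<le> 1 + width n * (1 - 3 / 512 * real (level b))"
      using width_block[OF that] by (intro integral_min_factor_le blocks.e_pos level_ge) simp
    also have "3 / 512 * real (level b) = 3 * 8 ^ b"
      by (simp add: level_def power_add)
    also have "1 + width n * (1 - 3 * 8 ^ b) \<le> exp (width n * (1 - 3 * 8 ^ b))"
      by (rule exp_ge_add_one_self)
    finally show ?thesis
      by (simp only: width_block[OF that])
  qed
  have "(LINT w|haar_polytorus. block_min b w)
      = (\<Prod>n\<in>?J. LINT z|haar_circle. min_factor (width n) (level b) (z ^ exponent n))"
    unfolding block_min_def by (intro integral_polytorus_prod m int) simp
  also have "\<dots> \<le> (\<Prod>n\<in>?J. exp ((1 / 2) ^ level b * (1 - 3 * 8 ^ b)))"
    by (intro prod_mono conjI le Bochner_Integration.integral_nonneg min_factor_nonneg level_ge)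
  also have "\<dots> = (\<Prod>n\<in>?J. exp (width n * (1 - 3 * 8 ^ b)))"
    by (intro prod.cong refl) (simp only: width_block)
  also have "\<dots> = exp ((\<Sum>n\<in>?J. width n) * (1 - 3 * 8 ^ b))"
    by (simp only: sum_distrib_right exp_sum finite_atLeastLessThan)
  also have "(\<Sum>n\<in>?J. width n) * (1 - 3 * 8 ^ b) \<le> - real b"
  proof -
    have "(1 / 4 :: real) ^ b * 8 ^ b = 2 ^ b"
      by (simp flip: power_mult_distrib)
    then have "(1 / 4 :: real) ^ b * (1 - 3 * 8 ^ b) = (1 / 4) ^ b - 3 * 2 ^ b"
      by (simp add: right_diff_distrib mult.left_commute)
    also have "\<dots> \<le> - real b"
    proof -
      have "(1 / 4 :: real) ^ b \<le> 1" "1 \<le> (2 :: real) ^ b" "real b < 2 ^ b"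
        by (simp_all add: power_le_one of_nat_less_two_power)
      then show ?thesis
        by linarith
    qed
    finally show ?thesis
      by (simp only: sum_width_block)
  qed
  also have "exp (- real b) = exp (- 1) ^ b"
    by (simp flip: exp_of_nat_mult)
  also have "\<dots> \<le> (1 / 2) ^ b"
  proof (rule power_mono)
    have "2 \<le> exp (1 :: real)"
      using exp_ge_add_one_self[of 1] by simp
    then show "exp (- 1) \<le> (1 / 2 :: real)"
      by (simp add: exp_minus field_simps)
  qed simp
  finally show "(LINT w|haar_polytorus. block_min b w) \<le> (1 / 2) ^ b"
    by simp
qed

lemma AE_block_min_tendsto_0: "AE w in haar_polytorus. (\<lambda>b. block_min b w) \<longlonglongrightarrow> 0"
proof -
  have "AE w in haar_polytorus. summable (\<lambda>b. block_min b w)"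
    by (rule AE_summable_of_integrals[OF integral_block_min(1) block_min_nonneg integral_block_min(2)])
       (simp add: summable_geometric)
  then show ?thesis
    by eventually_elim (rule summable_LIMSEQ_zero)
qed

text \<open>The choice attains the minimum for this w at every coordinate of the block. The product
  before it is at most exp 2, as the widths sum to at most 2, and the factors behind it equal
  1.\<close>

lemma exists_choice_small:
  assumes w: "\<And>n. cmod (w n) = 1"
  shows "\<exists>c\<in>choices b. cmod (blocks.extension (\<lambda>n. of_real (radius b c n) * w n)) \<le> exp 2 * block_min b w"
proof -
  let ?J = "{block_start b..<block_start (Suc b)}"
  have "\<exists>l. l \<in> {1..level b} \<and> cmod (factor (width n) (of_real (1 - (1 / 2) ^ l) * w n ^ exponent n))
      = min_factor (width n) (level b) (w n ^ exponent n)" for n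
    using min_factor_attained[OF level_ge(3)] by blast
  then obtain l where l: "\<And>n. l n \<in> {1..level b}"
      "\<And>n. cmod (factor (width n) (of_real (1 - (1 / 2) ^ l n) * w n ^ exponent n))
        = min_factor (width n) (level b) (w n ^ exponent n)"
    by metis
  define c where "c = restrict l ?J"
  have c: "c \<in> choices b"
    using l(1) by (auto simp: c_def choices_def)
  let ?z = "\<lambda>n. of_real (radius b c n) * w n"
  have z1: "cmod (?z n) < 1" for n
    using radius_bounds[of b c n] w[of n] by (simp add: norm_mult)
  have z0: "?z n = 0" if "block_start (Suc b) \<le> n" for n
    using that by (simp add: radius_def block_start_Suc)
  have block: "cmod (blocks.factors n (?z n)) = min_factor (width n) (level b) (w n ^ exponent n)" if "n \<in> ?J" for n
  proof -
    \<comment> \<open>The exponent undoes the root in \<open>radius\<close>: the factor sees a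
      dyadic radius.\<close>
    have "radius b c n ^ exponent n = 1 - (1 / 2) ^ l n"
      using that one_minus_half_power blocks.k_pos[of n] by (simp add: radius_def c_def)
    then have "?z n ^ exponent n = of_real (1 - (1 / 2) ^ l n) * w n ^ exponent n"
      by (simp only: power_mult_distrib of_real_power[symmetric])
    then show ?thesis
      by (simp only: blocks.factors_def l(2))
  qed
  have "blocks.extension ?z = (\<Prod>n<block_start (Suc b). blocks.factors n (?z n))"
    by (rule blocks.extension_finite_support[OF z1 z0])
  also have "\<dots> = (\<Prod>n<block_start b. blocks.factors n (?z n)) * (\<Prod>n\<in>?J. blocks.factors n (?z n))"
    by (simp only: blocks.prod_N_eq prod.lessThan_Suc)
  finally have "cmod (blocks.extension ?z)
      = cmod (\<Prod>n<block_start b. blocks.factors n (?z n)) * (\<Prod>n\<in>?J. cmod (blocks.factors n (?z n)))"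
    by (simp only: norm_mult prod_norm)
  also have "(\<Prod>n\<in>?J. cmod (blocks.factors n (?z n))) = block_min b w"
    unfolding block_min_def using block by (intro prod.cong refl)
  also have "cmod (\<Prod>n<block_start b. blocks.factors n (?z n)) * block_min b w \<le> exp 2 * block_min b w"
  proof (rule mult_right_mono[OF _ block_min_nonneg])
    have "cmod (\<Prod>n<block_start b. blocks.factors n (?z n)) \<le> exp (\<Sum>n<block_start b. width n)"
      using z1 by (intro blocks.norm_prod_factors_le less_imp_le)
    also have "\<dots> \<le> exp 2"
      using sum_width_le by simp
    finally show "cmod (\<Prod>n<block_start b. blocks.factors n (?z n)) \<le> exp 2" .
  qed
  finally show ?thesis
    using c by blast
qed

section \<open>The sequence of radii\<close>

lemma frequently_small_imp_subseq_tendsto_0: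
  fixes x :: "nat \<Rightarrow> complex"
  assumes "\<And>\<epsilon> M. 0 < \<epsilon> \<Longrightarrow> \<exists>s\<ge>M. cmod (x s) < \<epsilon>"
  shows "\<exists>\<sigma>. strict_mono \<sigma> \<and> (\<lambda>k. x (\<sigma> k)) \<longlonglongrightarrow> 0"
proof -
  have "\<exists>\<sigma>. \<forall>k. cmod (x (\<sigma> k)) < inverse (real (Suc k)) \<and> \<sigma> k < \<sigma> (Suc k)"
  proof (rule dependent_nat_choice)
    show "\<exists>s. cmod (x s) < inverse (real (Suc 0))"
      using assms[of "inverse (real (Suc 0))" 0] by auto
    show "\<exists>s'. cmod (x s') < inverse (real (Suc (Suc k))) \<and> s < s'" for s k
      using assms[of "inverse (real (Suc (Suc k)))" "Suc s"] by (auto simp: Suc_le_eq)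
  qed
  then obtain \<sigma> where \<sigma>: "\<And>k. cmod (x (\<sigma> k)) < inverse (real (Suc k))" "\<And>k. \<sigma> k < \<sigma> (Suc k)"
    by blast
  have "(\<lambda>k. x (\<sigma> k)) \<longlonglongrightarrow> 0"
  proof (rule Lim_null_comparison[OF _ LIMSEQ_inverse_real_of_nat])
    show "\<forall>\<^sub>F k in sequentially. cmod (x (\<sigma> k)) \<le> inverse (real (Suc k))"
      using \<sigma>(1) by (simp add: less_imp_le)
  qed
  then show ?thesis
    using \<sigma>(2) by (auto simp: strict_mono_Suc_iff)
qed

text \<open>Monotonicity in \<open>s\<close> is destroyed by inserting, before each \<open>S (Suc s)\<close>, radii that exceed it in the
  first \<open>s\<close> coordinates.\<close>

lemma interleave_not_monoseq:
  fixes S :: "nat \<Rightarrow> nat \<Rightarrow> real"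
  assumes bounds: "\<And>s n. 0 \<le> S s n" "\<And>s n. S s n < 1" and null: "\<And>s. S s \<longlonglongrightarrow> 0"
    and decseq: "\<And>s. decseq (S s)" and lim: "\<And>n. (\<lambda>s. S s n) \<longlonglongrightarrow> 1"
  shows "\<exists>R. (\<forall>s. R (2 * s) = S s) \<and> (\<forall>s n. 0 \<le> R s n \<and> R s n < 1) \<and> (\<forall>s. R s \<longlonglongrightarrow> 0)
    \<and> (\<forall>s. decseq (R s)) \<and> (\<forall>n. (\<lambda>s. R s n) \<longlonglongrightarrow> 1) \<and> (\<forall>n. \<not> monoseq (\<lambda>s. R s n))"
proof -
  define T where "T s n = (if n \<le> s then (1 + S (Suc s) 0) / 2 else 0)" for s n
  define R where "R s = (if even s then S (s div 2) else T (s div 2))" for s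
  have R_even: "R (2 * s) = S s" and R_odd: "R (Suc (2 * s)) = T s" for s
    by (simp_all add: R_def)
  have T_bounds: "0 \<le> T s n" "T s n < 1" for s n
    using bounds(1)[of "Suc s" 0] bounds(2)[of "Suc s" 0] by (auto simp: T_def)
  have T_null: "T s \<longlonglongrightarrow> 0" for s
    by (rule tendsto_eventually, rule eventually_sequentiallyI[of "Suc s"]) (simp add: T_def)
  have T_dec: "decseq (T s)" for s
    using bounds(1)[of "Suc s" 0] by (auto simp: decseq_def T_def)
  have T_lim: "(\<lambda>s. T s n) \<longlonglongrightarrow> 1" for n
  proof -
    have "(\<lambda>s. S (Suc s) 0) \<longlonglongrightarrow> 1"
      using lim[of 0] by (rule LIMSEQ_Suc)
    then have "(\<lambda>s. (1 + S (Suc s) 0) / 2) \<longlonglongrightarrow> (1 + 1) / 2"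
      by (intro tendsto_divide tendsto_add tendsto_const) simp_all
    then have "(\<lambda>s. (1 + S (Suc s) 0) / 2) \<longlonglongrightarrow> 1"
      by simp
    moreover have "\<forall>\<^sub>F s in sequentially. (1 + S (Suc s) 0) / 2 = T s n"
      by (rule eventually_sequentiallyI[of n]) (simp add: T_def)
    ultimately show ?thesis
      by (rule Lim_transform_eventually)
  qed
  have R_lim: "(\<lambda>s. R s n) \<longlonglongrightarrow> 1" for n
  proof -
    have half: "filterlim (\<lambda>s::nat. s div 2) at_top sequentially"
      unfolding filterlim_at_top
    proof
      fix Z :: nat
      show "\<forall>\<^sub>F s in sequentially. Z \<le> s div 2"
        by (rule eventually_sequentiallyI[of "2 * Z"]) linarith
    qed
    have "(\<lambda>s. if even s then S (s div 2) n else T (s div 2) n) \<longlonglongrightarrow> 1"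
      by (intro filterlim_If tendsto_mono[OF inf_le1] filterlim_compose[OF lim half]
            filterlim_compose[OF T_lim half])
    then show ?thesis
      by (simp add: R_def if_distrib[of "\<lambda>f. f n"])
  qed
  have "\<not> monoseq (\<lambda>s. R s n)" for n
  proof
    assume "monoseq (\<lambda>s. R s n)"
    then consider "incseq (\<lambda>s. R s n)" | "decseq (\<lambda>s. R s n)"
      by (auto simp: monoseq_iff)
    then show False
    proof cases
      case 1
      then have "R (Suc (2 * n)) n \<le> R (2 * Suc n) n"
        by (auto simp: incseq_def)
      then have "(1 + S (Suc n) 0) / 2 \<le> S (Suc n) n"
        unfolding R_odd R_even by (simp add: T_def)
      moreover have "S (Suc n) n \<le> S (Suc n) 0"
        using decseq by (auto simp: decseq_def)
      ultimately show False
        using bounds(2)[of "Suc n" 0] by simp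
    next
      \<comment> \<open>A decreasing sequence stays above its limit 1, but all radii are below
        1.\<close>
      case 2
      then have "1 \<le> R 0 n"
        using R_lim by (rule decseq_ge)
      then show False
        using bounds(2)[of 0 n] R_even[of 0] by simp
    qed
  qed
  moreover have "0 \<le> R s n \<and> R s n < 1" "R s \<longlonglongrightarrow> 0" "decseq (R s)" for s n
    using bounds T_bounds null T_null decseq T_dec by (auto simp: R_def)
  ultimately show ?thesis
    using R_even R_lim by blast
qed

text \<open>Pairs of a block and a choice are enumerated without repetition. As each block has
  finitely many choices, the block numbers tend to infinity, hence the radii to 1; as no pair is
  omitted, all choices of a late block occur at late indices.\<close>

lemma exists_radius_enumeration:
  obtains S :: "nat \<Rightarrow> nat \<Rightarrow> real"
  where "\<And>s n. 0 \<le> S s n" "\<And>s n. S s n < 1" "\<And>s. S s \<longlonglongrightarrow> 0" "\<And>s. decseq (S s)"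
    "\<And>n. (\<lambda>s. S s n) \<longlonglongrightarrow> 1"
    "\<And>M. \<forall>\<^sub>F b in sequentially. \<forall>c\<in>choices b. \<exists>s\<ge>M. S s = radius b c"
proof -
  define A where "A = (SIGMA b:UNIV. choices b)"
  have count: "countable A"
    unfolding A_def using finite_choices by (intro countable_SIGMA) (auto intro: countable_finite)
  have "fst ` A = UNIV"
    using choices_nonempty by (force simp: A_def image_iff)
  then have inf: "infinite A"
    using finite_imageI[of A fst] by auto
  have bij: "bij_betw (from_nat_into A) UNIV A"
    using count inf by (rule bij_betw_from_nat_into)
  define p where "p s = from_nat_into A s" for s
  have pA: "p s \<in> A" for s
    using bij by (auto simp: p_def bij_betw_def)
  then have p_choices: "snd (p s) \<in> choices (fst (p s))" for s
    by (cases "p s") (metis A_def SigmaD2 fst_conv snd_conv)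
  have inj: "inj p"
    using bij by (simp add: bij_betw_def p_def[abs_def])
  have fst_lim: "filterlim (\<lambda>s. fst (p s)) at_top sequentially"
    unfolding filterlim_at_top
  proof
    fix B
    have "{s. fst (p s) < B} \<subseteq> p -` (SIGMA b:{..<B}. choices b)"
    proof
      fix s assume "s \<in> {s. fst (p s) < B}"
      then have "(fst (p s), snd (p s)) \<in> (SIGMA b:{..<B}. choices b)"
        using p_choices by (intro SigmaI) simp_all
      then show "s \<in> p -` (SIGMA b:{..<B}. choices b)"
        by simp
    qed
    moreover have "finite (p -` (SIGMA b:{..<B}. choices b))"
      using inj finite_choices by (intro finite_vimageI) auto
    ultimately have "finite {s. fst (p s) < B}"
      by (rule finite_subset)
    then obtain m where "{s. fst (p s) < B} \<subseteq> {..<m}"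
      using finite_nat_bounded by blast
    then show "\<forall>\<^sub>F s in sequentially. B \<le> fst (p s)"
      by (intro eventually_sequentiallyI[of m]) (metis (mono_tags, lifting) lessThan_iff mem_Collect_eq not_less subsetD)
  qed
  define S where "S s = radius (fst (p s)) (snd (p s))" for s
  show ?thesis
  proof (rule that[of S])
    show "0 \<le> S s n" "S s n < 1" "S s \<longlonglongrightarrow> 0" "decseq (S s)" for s n
      using radius_bounds radius_tendsto_0 decseq_radius[OF p_choices] by (auto simp: S_def)
    show "(\<lambda>s. S s n) \<longlonglongrightarrow> 1" for n
    proof (rule tendsto_sandwich)
      have "(\<lambda>b. 1 - (1 / 2) ^ b) \<longlonglongrightarrow> 1 - (0 :: real)"
        by (intro tendsto_diff tendsto_const LIMSEQ_realpow_zero) auto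
      then have "((\<lambda>b. 1 - (1 / 2) ^ b) \<longlongrightarrow> (1 :: real)) sequentially"
        by simp
      then show "(\<lambda>s. 1 - (1 / 2) ^ fst (p s)) \<longlonglongrightarrow> (1 :: real)"
        using fst_lim by (rule filterlim_compose)
      have "\<forall>\<^sub>F s in sequentially. Suc n \<le> fst (p s)"
        using fst_lim by (simp add: filterlim_at_top)
      then show "\<forall>\<^sub>F s in sequentially. 1 - (1 / 2) ^ fst (p s) \<le> S s n"
      proof eventually_elim
        case (elim s)
        then have "n < block_start (fst (p s))"
          using strict_mono_imp_increasing[OF strict_mono_block_start, of "fst (p s)"] by simp
        then show ?case
          unfolding S_def by (rule radius_ge)
      qed
      show "\<forall>\<^sub>F s in sequentially. S s n \<le> 1"
        using radius_bounds(2) by (simp add: S_def less_imp_le)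
    qed (rule tendsto_const)
    fix M
    show "\<forall>\<^sub>F b in sequentially. \<forall>c\<in>choices b. \<exists>s\<ge>M. S s = radius b c"
    proof (rule eventually_sequentiallyI, intro ballI)
      \<comment> \<open>A block number above all those met up to index \<open>M\<close> can occur
        only after \<open>M\<close>.\<close>
      fix b c assume b: "Suc (Max ((\<lambda>s. fst (p s)) ` {..M})) \<le> b" and c: "c \<in> choices b"
      have "(b, c) \<in> A"
        using c by (simp add: A_def)
      then obtain s where s: "p s = (b, c)"
        using bij unfolding p_def bij_betw_def by (metis imageE)
      have "M \<le> s"
      proof (rule ccontr)
        assume "\<not> M \<le> s"
        then have "fst (p s) \<le> Max ((\<lambda>s. fst (p s)) ` {..M})"
          by (intro Max_ge) auto
        then show False
          using b s by simp
      qed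
      then show "\<exists>s\<ge>M. S s = radius b c"
        using s by (intro exI[of _ s]) (simp add: S_def)
    qed
  qed
qed

theorem theorem3p2:
  shows "\<exists>(fstar :: (nat \<Rightarrow> complex) \<Rightarrow> complex) (f :: (nat \<Rightarrow> complex) \<Rightarrow> complex)
           (R :: nat \<Rightarrow> nat \<Rightarrow> real).
           fstar \<in> Hinf_polytorus \<and>
           is_holomorphic_extension fstar f \<and>
           (AE w in haar_polytorus. fstar w \<noteq> 0) \<and>
           (\<forall>s n. 0 \<le> R s n \<and> R s n < 1) \<and>
           (\<forall>s. R s \<longlonglongrightarrow> 0) \<and>
           (\<forall>s. decseq (R s)) \<and>
           (\<forall>n. (\<lambda>s. R s n) \<longlonglongrightarrow> 1) \<and>
           (AE w in haar_polytorus.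
              (\<exists>\<sigma>. strict_mono \<sigma> \<and>
                 (\<lambda>k. f (\<lambda>n. of_real (R (\<sigma> k) n) * w n)) \<longlonglongrightarrow> 0) \<and>
              \<not> (\<lambda>s. f (\<lambda>n. of_real (R s n) * w n)) \<longlonglongrightarrow> fstar w) \<and>
           (\<forall>n. \<not> monoseq (\<lambda>s. R s n))"
proof -
  obtain S where S: "\<And>s n. 0 \<le> S s n" "\<And>s n. S s n < 1" "\<And>s. S s \<longlonglongrightarrow> 0" "\<And>s. decseq (S s)"
      "\<And>n. (\<lambda>s. S s n) \<longlonglongrightarrow> 1"
    and enum: "\<And>M. \<forall>\<^sub>F b in sequentially. \<forall>c\<in>choices b. \<exists>s\<ge>M. S s = radius b c"
    using exists_radius_enumeration by blast
  obtain R where R_even: "\<And>s. R (2 * s) = S s"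
    and R: "\<forall>s n. 0 \<le> R s n \<and> R s n < 1" "\<forall>s. R s \<longlonglongrightarrow> 0" "\<forall>s. decseq (R s)"
      "\<forall>n. (\<lambda>s. R s n) \<longlonglongrightarrow> 1" "\<forall>n. \<not> monoseq (\<lambda>s. R s n)"
    using interleave_not_monoseq[of S, OF S] by blast
  let ?F = "\<lambda>w s. blocks.extension (\<lambda>n. of_real (R s n) * w n)"
  have nonzero: "AE w in haar_polytorus. blocks.boundary w \<noteq> 0"
    using blocks.AE_boundary by eventually_elim simp
  have "AE w in haar_polytorus. (\<exists>\<sigma>. strict_mono \<sigma> \<and> (\<lambda>k. ?F w (\<sigma> k)) \<longlonglongrightarrow> 0)
      \<and> \<not> (\<lambda>s. ?F w s) \<longlonglongrightarrow> blocks.boundary w"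
    using nonzero AE_block_min_tendsto_0 blocks.AE_polytorus_norm
  proof eventually_elim
    case (elim w)
    \<comment> \<open>The good choice \<open>c\<close> depends on \<open>w\<close>, but its radii
      occur in the fixed sequence beyond every index \<open>M\<close>.\<close>
    have small: "\<exists>s\<ge>M. cmod (?F w s) < \<epsilon>" if "0 < \<epsilon>" for \<epsilon> M
    proof -
      have "(\<lambda>b. exp 2 * block_min b w) \<longlonglongrightarrow> exp 2 * 0"
        using elim(2) by (intro tendsto_mult tendsto_const)
      then have "\<forall>\<^sub>F b in sequentially. exp 2 * block_min b w < \<epsilon>"
        using that by (intro order_tendstoD(2)) auto
      with enum[of M] have "\<forall>\<^sub>F b in sequentially. exp 2 * block_min b w < \<epsilon> \<and>
          (\<forall>c\<in>choices b. \<exists>s\<ge>M. S s = radius b c)"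
        by eventually_elim simp
      then obtain b where b: "exp 2 * block_min b w < \<epsilon>" "\<forall>c\<in>choices b. \<exists>s\<ge>M. S s = radius b c"
        by (auto simp: eventually_sequentially)
      obtain c where c: "c \<in> choices b"
        "cmod (blocks.extension (\<lambda>n. of_real (radius b c n) * w n)) \<le> exp 2 * block_min b w"
        using exists_choice_small[of w b] elim(3) by blast
      obtain s where s: "M \<le> s" "S s = radius b c"
        using b(2) c(1) by blast
      \<comment> \<open>The small values sit at even indices, where \<open>R\<close> runs through
        \<open>S\<close>.\<close>
      have "cmod (?F w (2 * s)) < \<epsilon>"
        using c(2) b(1) unfolding R_even s(2) by simp
      then show ?thesis
        using s(1) by (intro exI[of _ "2 * s"]) simp
    qed
    then obtain \<sigma> where \<sigma>: "strict_mono \<sigma>" "(\<lambda>k. ?F w (\<sigma> k)) \<longlonglongrightarrow> 0"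
      using frequently_small_imp_subseq_tendsto_0[of "?F w"] by blast
    have "\<not> (\<lambda>s. ?F w s) \<longlonglongrightarrow> blocks.boundary w"
    proof
      assume "(\<lambda>s. ?F w s) \<longlonglongrightarrow> blocks.boundary w"
      from LIMSEQ_subseq_LIMSEQ[OF this \<sigma>(1)] have "(\<lambda>k. ?F w (\<sigma> k)) \<longlonglongrightarrow> blocks.boundary w"
        by (simp only: o_def)
      from LIMSEQ_unique[OF this \<sigma>(2)] show False
        using elim(1) by contradiction
    qed
    then show ?case
      by (intro conjI exI[of _ \<sigma>] \<sigma>)
  qed
  then show ?thesis
    by (intro exI[of _ blocks.boundary] exI[of _ blocks.extension] exI[of _ R] conjI R nonzero
        blocks.boundary_in_Hinf blocks.is_holomorphic_extension_boundary)
qed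

end
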